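(* Let $M^*\in\mathrm{Stab}_p$ and $C\in\mathrm{PD}_p$, let $\Sigma^*$ be the unique positive definite solution of $M^*\Sigma+\Sigma (M^* )^\top+C=0$, and suppose that $X_1,\dots,X_n$ are i.i.d. draws from $N(0,\Sigma^* )$, i.e. from the (centered) Gaussian equilibrium distribution of the $p$-dimensional Ornstein–Uhlenbeck process defined by drift matrix $M^*$ and volatility matrix $C$. Let $S=\{(j,k): M^*_{jk}\neq 0\}$ be the support of $M^*$, let $d=|S|$, and let $\Gamma^*=\Gamma(\Sigma^* )$ be the Gram matrix. Assume that $\Gamma^*_{SS}$ is invertible and that the irrepresentability condition $$|\!|\!|\Gamma^*_{S^cS}(\Gamma^*_{SS})^{-1}|\!|\!|_\infty<1-\alpha$$ holds for some $\alpha\in(0,1]$. Let $c_{\Gamma^*}=|\!|\!|(\Gamma^*_{SS})^{-1}|\!|\!|_\infty$, $c_{M^*}=\|\mathrm{vec}(M^* )\|_\infty$, $c_{\Sigma^*}=|\!|\!|\Sigma^*|\!|\!|_2$, $c_C=\|\mathrm{vec}(C)\|_2$, $$\tilde c=\max\left\{\frac{4\max\{1,c_{\Sigma^*}^2\}(4+8c_{\Sigma^*})^2}{c_3},\;16c_1^2c_{\Sigma^*}^2(4+8c_{\Sigma^*})^2,\;\frac{16\max\{1,c_{\Sigma^*}^2\}c_C^2}{c_3},\;64c_1^2c_{\Sigma^*}^2c_C^2\right\},\qquad c_*=\frac{6}{\alpha}c_{\Gamma^*},$$ where $c_1,c_2,c_3$ are the universal constants of the sub-Gaussian covariance concentration inequality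 given in the context, with $c_1>\max\{1,1/|\!|\!|\Sigma^*|\!|\!|_2\}$. Suppose that the sample size satisfies $n>\tau_1\tilde c\,d\,p\,\max\{c_*^2,1/4\}$ for some $\tau_1>1$, and that the regularization parameter is chosen as $$\lambda>\frac{3c_{M^*}(2-\alpha)}{\alpha}\sqrt{\frac{\tau_1\tilde c\,d\,p}{n}}.$$ Let $\hat M$ be a minimizer of the Direct Lyapunov Lasso problem $$\min_{M\in\mathbb{R}^{p\times p}}\ \tfrac12\|M\hat\Sigma+\hat\Sigma M^\top+C\|_F^2+\lambda\|M\|_1,\qquad \hat\Sigma=\frac1n\sum_{i=1}^nX_iX_i^\top,$$ and let $\hat S=\{(j,k):\hat M_{jk}\ne0\}$. Then the following statements hold with probability at least $1-c_2\exp(-\tau_1p)$: (a) The minimizer $\hat M$ is unique, has its support included in the true support ($\hat S\subseteq S$), and satisfies $$\|\hat M-M^*\|_\infty<\frac{2c_{\Gamma^*}}{2-\alpha}\lambda.$$ (b) Furthermore, if $$\min_{(j,k)\in S}|M^*_{jk}|>\frac{2c_{\Gamma^*}}{2-\alpha}\lambda,$$ then $\hat S=S$ and $\mathrm{sign}(\hat M_{jk})=\mathrm{sign}(M^*_{jk})$ for all $(j,k)\in S$.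
   Context: $\mathrm{Stab}_p$ is the set of stable matrices in $\mathbb{R}^{p\times p}$ (all eigenvalues have strictly negative real part); $\mathrm{PD}_p$ is the cone of symmetric positive definite $p\times p$ matrices. The Ornstein–Uhlenbeck process solves $\mathrm{d}X(t)=M^*X(t)\,\mathrm{d}t+D\,\mathrm{d}W(t)$ with $DD^\top=C$; its equilibrium distribution is $N(0,\Sigma^* )$ (the mean is taken to be $0$ without loss of generality, and $C$ is known). Norms: for a matrix $A$, $\|A\|_b$ is the entrywise $\ell_b$-norm (so $\|A\|_1=\sum|a_{ij}|$, $\|A\|_\infty=\max|a_{ij}|$), $\|A\|_F=\|A\|_2$ is the Frobenius norm, $|\!|\!|A|\!|\!|_2$ is the spectral norm and $|\!|\!|A|\!|\!|_\infty=\max_i\sum_j|a_{ij}|$ is the maximum absolute row sum. $\mathrm{vec}$ stacks columns; rows and columns of $p^2\times p^2$ matrices are indexed by pairs $(j,k)$, with $(j,k)$ corresponding to the position of $M_{jk}$ in $\mathrm{vec}(M)$. $K^{(p,p)}$ is the commutation matrix, i.e. the permutation matrix with $K^{(p,p)}\mathrm{vec}(A)=\mathrm{vec}(A^\top)$. Define $$A(\Sigma)=(\Sigma\otimes I_p)+(I_p\otimes\Sigma)K^{(p,p)}\in\mathbb{R}^{p^2\times p^2},\qquad \Gamma(\Sigma)=A(\Sigma)^\top A(\Sigma).$$ For index sets $S,T$, $\Gamma_{TS}$ is the submatrix with rows in $T$ and columns in $S$; $S^c$ is the complement of $S$ in $\{1,\dots,p\}^2$. Universal constants: $c_1,c_2,c_3>0$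 are such that for i.i.d. centered $\sigma$-sub-Gaussian random vectors $X_1,\dots,X_n$ in $\mathbb{R}^p$ (meaning $\mathbb{E}e^{t\langle v,X_i\rangle}\le e^{\sigma^2t^2/2}$ for all unit vectors $v$ and all $t\in\mathbb{R}$) with covariance matrix $\Sigma^*$ and $\hat\Sigma=\frac1n\sum_iX_iX_i^\top$, $$\mathbb{P}\left(\frac{|\!|\!|\hat\Sigma-\Sigma^*|\!|\!|_2}{\sigma^2}\ge c_1\left\{\sqrt{\tfrac pn}+\tfrac pn\right\}+\delta\right)\le c_2\exp(-c_3n\min\{\delta,\delta^2\})\quad\text{for all }\delta\ge0.$$ This is a known inequality; the constant $c_1$ may be increased so that the lower bound required of it in the statement holds. *)

theory Defs
  imports "HOL-Probability.Probability"
begin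

section \<open>Stable and positive definite matrices\<close>

definition eigenvalue_of :: "real^'n^'n \<Rightarrow> complex \<Rightarrow> bool" where
  "eigenvalue_of A l \<longleftrightarrow>
     (\<exists>v :: complex^'n. v \<noteq> 0 \<and> (\<chi> i j. complex_of_real (A $ i $ j)) *v v = l *s v)"

definition stable :: "real^'n^'n \<Rightarrow> bool" where
  "stable A \<longleftrightarrow> (\<forall>l. eigenvalue_of A l \<longrightarrow> Re l < 0)"

definition pos_def :: "real^'n^'n \<Rightarrow> bool" where
  "pos_def A \<longleftrightarrow> transpose A = A \<and> (\<forall>v. v \<noteq> 0 \<longrightarrow> v \<bullet> (A *v v) > 0)"

section \<open>Matrix norms\<close>

text \<open>The Frobenius norm is the library's \<^term>\<open>norm\<close> on \<open>real^'n^'m\<close>, and the entrywise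
  maximum norm is \<^term>\<open>infnorm\<close>.\<close>

definition entry_norm1 :: "real^'n^'m \<Rightarrow> real" where
  "entry_norm1 A = (\<Sum>i\<in>UNIV. \<Sum>j\<in>UNIV. \<bar>A $ i $ j\<bar>)"

definition spectral_norm :: "real^'n^'m \<Rightarrow> real" where
  "spectral_norm A = onorm (\<lambda>v. A *v v)"

definition row_sum_norm :: "real^'n^'m \<Rightarrow> real" where
  "row_sum_norm A = Max (range (\<lambda>i. \<Sum>j\<in>UNIV. \<bar>A $ i $ j\<bar>))"

section \<open>Vectorization, Kronecker product and Gram matrix\<close>

text \<open>Coordinate \<open>(j, k)\<close> of a vector in \<open>real^('p \<times> 'p)\<close> stands for the position of the entry
  in row \<open>j\<close>, column \<open>k\<close> in the column-stacking vectorization. The row index \<open>j\<close> is therefore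
  the fast one, so that entry \<open>((j,k),(l,m))\<close> of the Kronecker product of \<open>A\<close> and \<open>B\<close> lies in
  the block with coordinates \<open>(k,m)\<close>, and is the entry of \<open>B\<close> at \<open>(j,l)\<close> scaled by the entry of
  \<open>A\<close> at \<open>(k,m)\<close>. The lemmas below confirm the convention.\<close>

definition vectorize :: "real^'p^'p \<Rightarrow> real^('p \<times> 'p)" where
  "vectorize A = (\<chi> r. A $ fst r $ snd r)"

definition kron :: "real^'p^'p \<Rightarrow> real^'p^'p \<Rightarrow> real^('p \<times> 'p)^('p \<times> 'p)" where
  "kron A B = (\<chi> r c. A $ snd r $ snd c * B $ fst r $ fst c)"

definition commutation_matrix :: "real^('p::finite \<times> 'p)^('p \<times> 'p)" where
  "commutation_matrix = (\<chi> r c. if c = (snd r, fst r) then 1 else 0)"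

definition lyap_matrix :: "real^'p^'p \<Rightarrow> real^('p \<times> 'p)^('p \<times> 'p)" where
  "lyap_matrix \<Sigma> = kron \<Sigma> (mat 1) + kron (mat 1) \<Sigma> ** commutation_matrix"

definition gram_matrix :: "real^'p^'p \<Rightarrow> real^('p \<times> 'p)^('p \<times> 'p)" where
  "gram_matrix \<Sigma> = transpose (lyap_matrix \<Sigma>) ** lyap_matrix \<Sigma>"

lemma commutation_matrix_vectorize:
  "commutation_matrix *v vectorize A = vectorize (transpose A)"
  by (simp add: vec_eq_iff matrix_vector_mult_def commutation_matrix_def vectorize_def
      transpose_def if_distrib[where f = "\<lambda>x. x * _"] cong: if_cong)

lemma kron_vectorize:
  "kron A B *v vectorize M = vectorize (B ** M ** transpose A)"
proof -
  have "(\<Sum>c\<in>UNIV. A $ k $ snd c * B $ j $ fst c * M $ fst c $ snd c)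
      = (\<Sum>m\<in>UNIV. (\<Sum>l\<in>UNIV. B $ j $ l * M $ l $ m) * A $ k $ m)" for j k
  proof -
    have "(\<Sum>c\<in>UNIV. A $ k $ snd c * B $ j $ fst c * M $ fst c $ snd c)
        = (\<Sum>l\<in>UNIV. \<Sum>m\<in>UNIV. A $ k $ m * B $ j $ l * M $ l $ m)"
      by (simp add: sum.cartesian_product case_prod_beta)
    also have "\<dots> = (\<Sum>m\<in>UNIV. \<Sum>l\<in>UNIV. A $ k $ m * B $ j $ l * M $ l $ m)"
      by (rule sum.swap)
    finally show ?thesis
      by (simp add: sum_distrib_left sum_distrib_right mult_ac)
  qed
  then show ?thesis
    by (simp add: vec_eq_iff matrix_vector_mult_def matrix_matrix_mult_def kron_def
        vectorize_def transpose_def)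
qed

lemma lyap_matrix_vectorize:
  assumes "transpose \<Sigma> = \<Sigma>"
  shows "lyap_matrix \<Sigma> *v vectorize M = vectorize (M ** \<Sigma> + \<Sigma> ** transpose M)"
proof -
  have "vectorize (A + B) = vectorize A + vectorize B" for A B :: "real^'a^'a"
    by (simp add: vectorize_def vec_eq_iff)
  then show ?thesis
    using assms by (simp add: lyap_matrix_def matrix_vector_mult_add_rdistrib kron_vectorize
        commutation_matrix_vectorize matrix_vector_mul_assoc[symmetric] transpose_mat)
qed

section \<open>Submatrices\<close>

text \<open>The submatrix with rows in \<open>T\<close> and columns in \<open>S\<close>, padded with zeros to full size. Padding
  is compatible with products and leaves \<^term>\<open>row_sum_norm\<close> unchanged; a submatrix without rows
  gets norm 0. The inverse of the \<open>S\<close>-by-\<open>S\<close> submatrix is padded in the same way.\<close>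

definition submat :: "'m set \<Rightarrow> 'n set \<Rightarrow> real^'n^'m \<Rightarrow> real^'n^'m" where
  "submat T S A = (\<chi> i j. if i \<in> T \<and> j \<in> S then A $ i $ j else 0)"

definition is_submat_inv :: "'n set \<Rightarrow> real^'n^'n \<Rightarrow> real^'n^'n \<Rightarrow> bool" where
  "is_submat_inv S A B \<longleftrightarrow> submat S S B = B \<and>
     submat S S A ** B = submat S S (mat 1) \<and> B ** submat S S A = submat S S (mat 1)"

definition submat_invertible :: "'n set \<Rightarrow> real^'n^'n \<Rightarrow> bool" where
  "submat_invertible S A \<longleftrightarrow> (\<exists>B. is_submat_inv S A B)"

definition submat_inv :: "'n set \<Rightarrow> real^'n^'n \<Rightarrow> real^'n^'n" where
  "submat_inv S A = (THE B. is_submat_inv S A B)"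

definition mat_support :: "real^'p^'p \<Rightarrow> ('p \<times> 'p) set" where
  "mat_support M = {(j, k). M $ j $ k \<noteq> 0}"

section \<open>Probability\<close>

definition centered_gaussian :: "real^'p^'p \<Rightarrow> (real^'p) measure" where
  "centered_gaussian \<Sigma> = density lborel
     (\<lambda>x. ennreal (exp (- (x \<bullet> (matrix_inv \<Sigma> *v x)) / 2) / sqrt ((2 * pi) ^ CARD('p) * det \<Sigma>)))"

definition cov_matrix :: "(real^'p) measure \<Rightarrow> real^'p^'p" where
  "cov_matrix \<mu> = (let m = (\<integral>x. x \<partial>\<mu>) in
     \<chi> j k. \<integral>x. (x $ j - m $ j) * (x $ k - m $ k) \<partial>\<mu>)"

definition sub_gaussian :: "real \<Rightarrow> (real^'p) measure \<Rightarrow> bool" where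
  "sub_gaussian \<sigma> \<mu> \<longleftrightarrow> (\<forall>v t. norm v = 1 \<longrightarrow>
     integrable \<mu> (\<lambda>x. exp (t * (v \<bullet> x))) \<and>
     (\<integral>x. exp (t * (v \<bullet> x)) \<partial>\<mu>) \<le> exp (\<sigma>\<^sup>2 * t\<^sup>2 / 2))"

definition sample_cov :: "nat \<Rightarrow> (nat \<Rightarrow> real^'p) \<Rightarrow> real^'p^'p" where
  "sample_cov n x = (\<chi> j k. (\<Sum>i<n. x i $ j * x i $ k) / real n)"

text \<open>The defining property of the universal constants, for random vectors in \<open>real^'p\<close>. An
  i.i.d. sample of size \<open>n\<close> is represented by its joint law, the \<open>n\<close>-fold product of the common
  law \<open>\<mu>\<close>, so that the property does not depend on an underlying sample space.\<close>

definition cov_concentration ::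
    "'p::finite itself \<Rightarrow> real \<Rightarrow> real \<Rightarrow> real \<Rightarrow> bool" where
  "cov_concentration (_ :: 'p itself) c1 c2 c3 \<longleftrightarrow>
     (\<forall>(\<mu> :: (real^'p) measure) (\<sigma>::real) (n::nat) (\<delta>::real).
        prob_space \<mu> \<and> sets \<mu> = sets borel \<and> (\<integral>x. x \<partial>\<mu>) = 0 \<and>
        \<sigma> > 0 \<and> sub_gaussian \<sigma> \<mu> \<and> n \<ge> 1 \<and> \<delta> \<ge> 0 \<longrightarrow>
        measure (PiM {..<n} (\<lambda>_. \<mu>))
          {x \<in> space (PiM {..<n} (\<lambda>_. \<mu>)).
             spectral_norm (sample_cov n x - cov_matrix \<mu>) / \<sigma>\<^sup>2
               \<ge> c1 * (sqrt (real CARD('p) / real n) + real CARD('p) / real n) + \<delta>}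
          \<le> c2 * exp (- c3 * real n * min \<delta> (\<delta>\<^sup>2)))"

section \<open>The Direct Lyapunov Lasso\<close>

definition lyap_lasso_objective ::
    "real^'p^'p \<Rightarrow> real \<Rightarrow> real^'p^'p \<Rightarrow> real^'p^'p \<Rightarrow> real" where
  "lyap_lasso_objective C lam \<Sigma> M =
     (norm (M ** \<Sigma> + \<Sigma> ** transpose M + C))\<^sup>2 / 2 + lam * entry_norm1 M"

definition lyap_lasso_minimizer ::
    "real^'p^'p \<Rightarrow> real \<Rightarrow> real^'p^'p \<Rightarrow> real^'p^'p \<Rightarrow> bool" where
  "lyap_lasso_minimizer C lam \<Sigma> M \<longleftrightarrow>
     is_arg_min (lyap_lasso_objective C lam \<Sigma>) (\<lambda>_. True) M"

end

theory Submission
  imports Defs "HOL-Real_Asymp.Real_Asymp"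
begin

text \<open>
  Vectorized, the Direct Lyapunov Lasso is an ordinary lasso with design matrix
  \<open>A(\<Sigma>hat)\<close> and response \<open>- vec C\<close>, except that the design is random and the true parameter
  solves the linear system exactly only at \<open>\<Sigma>star\<close>. The proof is a primal-dual witness argument:
  minimize the objective over matrices supported in \<open>S\<close>, show that the gradient at this restricted
  minimizer is strictly smaller than the penalty level off \<open>S\<close>, and conclude that the restricted
  minimizer is the unique global one (\<open>lasso_minimizer_unique_if_dual_certificate\<close>). The strict
  bound and the error bound both come from inverting the Gram matrix \<open>\<Gamma>star\<close> on \<open>S\<close> and treating
  two quantities as small: the perturbation of the Gram matrix, as an operator on vectors
  supported in \<open>S\<close> with the maximum norm, and the gradient at the true parameter
  (\<open>lasso_support_recovery\<close>).

  Since \<open>A(\<Sigma>)\<close> is linear in \<open>\<Sigma>\<close> and \<open>A(\<Sigma>star) vec Mstar = - vec C\<close>, the residual at the true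
  parameter is \<open>A(\<Sigma>hat - \<Sigma>star) vec Mstar\<close>. Hence with \<open>t\<close> a bound on the spectral norm of
  \<open>\<Sigma>hat - \<Sigma>star\<close>, both small quantities are controlled by the single number
  \<open>\<epsilon> = (4 + 8 c_\<Sigma>) t sqrt d\<close>: the first by \<open>\<epsilon>\<close> and the second by \<open>c_M \<epsilon>\<close>
  (\<open>gram_matrix_perturbation\<close>, \<open>lyap_gradient_at_truth\<close>). Bounding the gradient through this
  factorization, and not through separate deviations of the Gram matrix and of \<open>A(\<Sigma>hat)\<^sup>T vec C\<close>,
  is what makes a penalty level proportional to \<open>c_M\<close> sufficient even when \<open>c_M\<close> is small.

  The probability enters only through the event that the spectral deviation is below \<open>t\<close>.
  The Gaussian law is sub-Gaussian with parameter \<open>sqrt c_\<Sigma>\<close>: completing the square shows that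
  an exponential tilt of its density is a translate of it, which gives the moment generating
  function (\<open>centered_gaussian_mgf\<close>), and the covariance matrix is read off from the second-order
  behaviour of that function at 0. The choice of \<open>t\<close> for which \<open>\<epsilon>\<close> is the square root in the
  bound on the penalty level is made in \<open>sample_size_constants\<close>: half of it absorbs the
  dimension term of the concentration inequality and half the deviation \<open>\<delta>\<close>.
\<close>

section \<open>Optimality in the lasso\<close>

definition lasso_objective :: "real^'q^'m \<Rightarrow> real^'m \<Rightarrow> real \<Rightarrow> real^'q \<Rightarrow> real" where
  "lasso_objective A c lam m = (norm (A *v m + c))\<^sup>2 / 2 + lam * (\<Sum>j\<in>UNIV. \<bar>m $ j\<bar>)"

definition lasso_gradient :: "real^'q^'m \<Rightarrow> real^'m \<Rightarrow> real^'q \<Rightarrow> real^'q" where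
  "lasso_gradient A c m = transpose A *v (A *v m + c)"

lemma lasso_objective_add:
  "lasso_objective A c lam (m + h) = lasso_objective A c lam m
     + (\<Sum>j\<in>UNIV. h $ j * lasso_gradient A c m $ j + lam * (\<bar>m $ j + h $ j\<bar> - \<bar>m $ j\<bar>))
     + (norm (A *v h))\<^sup>2 / 2"
proof -
  have "(norm (A *v (m + h) + c))\<^sup>2
      = (norm (A *v m + c))\<^sup>2 + 2 * ((A *v h) \<bullet> (A *v m + c)) + (norm (A *v h))\<^sup>2"
    unfolding power2_norm_eq_inner
    by (simp add: matrix_vector_right_distrib inner_add_left inner_add_right inner_commute
        algebra_simps)
  moreover have "(A *v h) \<bullet> (A *v m + c) = (\<Sum>j\<in>UNIV. h $ j * lasso_gradient A c m $ j)"
  proof -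
    have "(\<Sum>j\<in>UNIV. h $ j * lasso_gradient A c m $ j) = h \<bullet> lasso_gradient A c m"
      by (simp add: inner_vec_def)
    also have "\<dots> = (A *v m + c) \<bullet> (A *v h)"
      by (simp add: lasso_gradient_def inner_commute[of h] dot_lmul_matrix)
    finally show ?thesis by (simp add: inner_commute)
  qed
  ultimately show ?thesis
    by (simp add: lasso_objective_def sum.distrib sum_subtractf sum_distrib_left[symmetric]
        algebra_simps add_divide_distrib)
qed

text \<open>Replace \<open>s\<close> by a small multiple \<open>e * s\<close>: by convexity the change of the absolute value scales
  at most linearly in \<open>e\<close>, while the quadratic term is of order \<open>e\<^sup>2\<close> and disappears after division
  by \<open>e\<close>. This turns minimality along a coordinate into the subgradient condition without
  mentioning subgradients.\<close>
lemma abs_subgradient_if_quadratic_nonneg: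
  fixes g a l x s :: real
  assumes nonneg: "\<And>s. 0 \<le> s * g + l * (\<bar>x + s\<bar> - \<bar>x\<bar>) + s\<^sup>2 * a" and l: "0 \<le> l"
  shows "0 \<le> s * g + l * (\<bar>x + s\<bar> - \<bar>x\<bar>)"
proof (rule ccontr)
  define K where "K = s * g + l * (\<bar>x + s\<bar> - \<bar>x\<bar>)"
  assume "\<not> ?thesis"
  then have K: "K < 0" by (simp add: K_def)
  have *: "0 \<le> K + e * (s\<^sup>2 * a)" if e: "0 < e" "e \<le> 1" for e
  proof -
    have "x + e * s = (1 - e) * x + e * (x + s)" by (simp add: algebra_simps)
    then have "\<bar>x + e * s\<bar> \<le> \<bar>(1 - e) * x\<bar> + \<bar>e * (x + s)\<bar>" by (metis abs_triangle_ineq)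
    also have "\<dots> = \<bar>x\<bar> + e * (\<bar>x + s\<bar> - \<bar>x\<bar>)"
      using e by (simp only: abs_mult) (simp add: algebra_simps)
    finally have "l * (\<bar>x + e * s\<bar> - \<bar>x\<bar>) \<le> l * (e * (\<bar>x + s\<bar> - \<bar>x\<bar>))"
      using l by (intro mult_left_mono) auto
    with nonneg[of "e * s"] have "0 \<le> e * (K + e * (s\<^sup>2 * a))"
      by (simp add: K_def algebra_simps power2_eq_square)
    then show ?thesis using e by (simp add: zero_le_mult_iff)
  qed
  have "((\<lambda>e. K + e * (s\<^sup>2 * a)) \<longlongrightarrow> K + 0 * (s\<^sup>2 * a)) (at_right 0)"
    by (intro tendsto_intros)
  moreover have "eventually (\<lambda>e. 0 \<le> K + e * (s\<^sup>2 * a)) (at_right (0::real))"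
    using * eventually_at_right_real[of 0 1] by (auto elim!: eventually_mono)
  ultimately have "0 \<le> K + 0 * (s\<^sup>2 * a)" by (intro tendsto_lowerbound) auto
  with K show False by simp
qed

text \<open>Outside the ball of radius \<open>lasso_objective A c lam 0 / lam\<close> the penalty alone exceeds the
  value at 0, so minimizing over a compact set suffices.\<close>
lemma lasso_restricted_minimizer_exists:
  fixes A :: "real^'q^'m"
  assumes lam: "0 < lam"
  obtains m where "\<And>j. j \<notin> S \<Longrightarrow> m $ j = 0"
    and "\<And>m'. (\<And>j. j \<notin> S \<Longrightarrow> m' $ j = 0) \<Longrightarrow> lasso_objective A c lam m \<le> lasso_objective A c lam m'"
proof -
  define V where "V = {m :: real^'q. \<forall>j. j \<notin> S \<longrightarrow> m $ j = 0}"
  define R where "R = lasso_objective A c lam 0 / lam"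
  have R: "0 \<le> R" using lam by (simp add: R_def lasso_objective_def)
  have "V = (\<Inter>j\<in>-S. {m. m $ j = 0})" by (auto simp: V_def)
  moreover have "closed {m :: real^'q. m $ j = 0}" for j
    by (intro closed_Collect_eq continuous_intros)
  ultimately have "closed V" by auto
  then have "compact (cball 0 R \<inter> V)" by (intro compact_Int_closed) auto
  moreover have "0 \<in> cball 0 R \<inter> V" using R by (simp add: V_def)
  moreover have "continuous_on (cball 0 R \<inter> V) (lasso_objective A c lam)"
    unfolding lasso_objective_def
    by (intro continuous_intros matrix_vector_mult_linear_continuous_on) simp
  ultimately obtain m where m: "m \<in> cball 0 R \<inter> V"
    and min: "\<And>m'. m' \<in> cball 0 R \<inter> V \<Longrightarrow> lasso_objective A c lam m \<le> lasso_objective A c lam m'"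
    using continuous_attains_inf[of "cball 0 R \<inter> V" "lasso_objective A c lam"] by blast
  show thesis
  proof
    show "m $ j = 0" if "j \<notin> S" for j using m that by (simp add: V_def)
    show "lasso_objective A c lam m \<le> lasso_objective A c lam m'"
      if m': "\<And>j. j \<notin> S \<Longrightarrow> m' $ j = 0" for m'
    proof (cases "norm m' \<le> R")
      case True
      then show ?thesis using m' by (intro min) (auto simp: V_def)
    next
      case False
      have "lasso_objective A c lam m \<le> lasso_objective A c lam 0"
        using R by (intro min) (auto simp: V_def)
      also have "\<dots> = lam * R" using lam by (simp add: R_def)
      also have "\<dots> \<le> lam * (\<Sum>j\<in>UNIV. \<bar>m' $ j\<bar>)"
        using False norm_le_l1_cart[of m'] lam by (intro mult_left_mono) auto
      also have "\<dots> \<le> lasso_objective A c lam m'" by (simp add: lasso_objective_def)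
      finally show ?thesis .
    qed
  qed
qed

lemma lasso_stationarity_on_support:
  assumes lam: "0 < lam" and supp: "\<And>j. j \<notin> S \<Longrightarrow> m $ j = 0"
    and min: "\<And>m'. (\<And>j. j \<notin> S \<Longrightarrow> m' $ j = 0) \<Longrightarrow>
               lasso_objective A c lam m \<le> lasso_objective A c lam m'"
    and j: "j \<in> S"
  shows "0 \<le> s * lasso_gradient A c m $ j + lam * (\<bar>m $ j + s\<bar> - \<bar>m $ j\<bar>)"
proof (rule abs_subgradient_if_quadratic_nonneg[where a = "(norm (A *v axis j 1))\<^sup>2 / 2"])
  fix s :: real
  let ?h = "axis j s"
  have h: "?h = s *\<^sub>R axis j 1" by (simp add: vec_eq_iff axis_def)
  have "lasso_objective A c lam m \<le> lasso_objective A c lam (m + ?h)"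
    using supp j by (intro min) (auto simp: axis_def)
  moreover have "(\<Sum>k\<in>UNIV. ?h $ k * lasso_gradient A c m $ k + lam * (\<bar>m $ k + ?h $ k\<bar> - \<bar>m $ k\<bar>))
      = (\<Sum>k\<in>{j}. s * lasso_gradient A c m $ k + lam * (\<bar>m $ k + s\<bar> - \<bar>m $ k\<bar>))"
    by (intro sum.mono_neutral_cong_right) (auto simp: axis_def)
  moreover have "(norm (A *v ?h))\<^sup>2 = s\<^sup>2 * (norm (A *v axis j 1))\<^sup>2"
    unfolding h by (simp add: matrix_vector_mult_scaleR power_mult_distrib)
  ultimately show "0 \<le> s * lasso_gradient A c m $ j + lam * (\<bar>m $ j + s\<bar> - \<bar>m $ j\<bar>)
      + s\<^sup>2 * ((norm (A *v axis j 1))\<^sup>2 / 2)"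
    by (simp add: lasso_objective_add)
qed (use lam in simp)

text \<open>The increment of the objective is a sum of coordinate terms plus the square of a norm. The terms in
  \<open>S\<close> are nonnegative by stationarity; off \<open>S\<close> they dominate a positive multiple of the absolute value of the entry.
  Another minimizer therefore has support in \<open>S\<close> and differs by a vector in the kernel of \<open>A\<close>.\<close>
lemma lasso_minimizer_unique_if_dual_certificate:
  fixes A :: "real^'q^'m"
  assumes stat: "\<And>j s. j \<in> S \<Longrightarrow>
                  0 \<le> s * lasso_gradient A c m $ j + lam * (\<bar>m $ j + s\<bar> - \<bar>m $ j\<bar>)"
    and supp: "\<And>j. j \<notin> S \<Longrightarrow> m $ j = 0"
    and strict: "\<And>j. j \<notin> S \<Longrightarrow> \<bar>lasso_gradient A c m $ j\<bar> < lam"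
    and inj: "\<And>u. (\<And>j. j \<notin> S \<Longrightarrow> u $ j = 0) \<Longrightarrow> A *v u = 0 \<Longrightarrow> u = 0"
    and le: "lasso_objective A c lam m' \<le> lasso_objective A c lam m"
  shows "m' = m"
proof -
  define h where "h = m' - m"
  define t where "t j = h $ j * lasso_gradient A c m $ j + lam * (\<bar>m $ j + h $ j\<bar> - \<bar>m $ j\<bar>)" for j
  have off: "(lam - \<bar>lasso_gradient A c m $ j\<bar>) * \<bar>h $ j\<bar> \<le> t j" if "j \<notin> S" for j
  proof -
    have "- (\<bar>h $ j\<bar> * \<bar>lasso_gradient A c m $ j\<bar>) \<le> h $ j * lasso_gradient A c m $ j"
      using abs_ge_minus_self[of "h $ j * lasso_gradient A c m $ j"] by (simp add: abs_mult)
    then show ?thesis using supp[OF that] by (simp add: t_def algebra_simps)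
  qed
  have t: "0 \<le> t j" for j
  proof (cases "j \<in> S")
    case True
    then show ?thesis unfolding t_def by (rule stat)
  next
    case False
    have "0 \<le> (lam - \<bar>lasso_gradient A c m $ j\<bar>) * \<bar>h $ j\<bar>" using strict[OF False] by simp
    then show ?thesis using off[OF False] by simp
  qed
  have "lasso_objective A c lam m' = lasso_objective A c lam m + (\<Sum>j\<in>UNIV. t j) + (norm (A *v h))\<^sup>2 / 2"
    using lasso_objective_add[of A c lam m h] by (simp add: h_def t_def)
  with le have *: "(\<Sum>j\<in>UNIV. t j) + (norm (A *v h))\<^sup>2 / 2 \<le> 0" by simp
  moreover have sum0: "0 \<le> (\<Sum>j\<in>UNIV. t j)" using t by (intro sum_nonneg) auto
  ultimately have "(norm (A *v h))\<^sup>2 \<le> 0" by linarith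
  then have Ah: "A *v h = 0" by simp
  with * sum0 have "(\<Sum>j\<in>UNIV. t j) = 0" by simp
  then have t0: "t j = 0" for j using t by (simp add: sum_nonneg_eq_0_iff)
  have "h $ j = 0" if j: "j \<notin> S" for j
  proof (rule ccontr)
    assume "h $ j \<noteq> 0"
    then have "0 < (lam - \<bar>lasso_gradient A c m $ j\<bar>) * \<bar>h $ j\<bar>" using strict[OF j] by simp
    with off[OF j] t0[of j] show False by simp
  qed
  then have "h = 0" using inj Ah by blast
  then show ?thesis by (simp add: h_def)
qed

section \<open>Padded submatrices and their inverses\<close>

lemma row_sum_norm_bound:
  fixes A :: "real^'n^'m"
  assumes x: "\<And>j. A $ i $ j \<noteq> 0 \<Longrightarrow> \<bar>x $ j\<bar> \<le> K" and K: "0 \<le> K"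
  shows "\<bar>(A *v x) $ i\<bar> \<le> row_sum_norm A * K"
proof -
  have "\<bar>(A *v x) $ i\<bar> \<le> (\<Sum>j\<in>UNIV. \<bar>A $ i $ j * x $ j\<bar>)"
    by (simp add: matrix_vector_mult_def sum_abs)
  also have "\<dots> \<le> (\<Sum>j\<in>UNIV. \<bar>A $ i $ j\<bar> * K)"
  proof (intro sum_mono)
    show "\<bar>A $ i $ j * x $ j\<bar> \<le> \<bar>A $ i $ j\<bar> * K" for j
      using x[of j] by (cases "A $ i $ j = 0") (auto simp: abs_mult intro: mult_left_mono)
  qed
  also have "\<dots> = (\<Sum>j\<in>UNIV. \<bar>A $ i $ j\<bar>) * K" by (simp add: sum_distrib_right)
  also have "\<dots> \<le> row_sum_norm A * K"
    unfolding row_sum_norm_def using K by (intro mult_right_mono Max_ge) auto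
  finally show ?thesis .
qed

lemma row_sum_norm_nonneg: "0 \<le> row_sum_norm A"
  using row_sum_norm_bound[of A undefined 0 1] by simp

lemma submat_fixed_zero:
  assumes "submat S T B = B" and "i \<notin> S \<or> j \<notin> T"
  shows "B $ i $ j = 0"
proof -
  have "B $ i $ j = submat S T B $ i $ j" using assms(1) by simp
  then show ?thesis using assms(2) by (auto simp: submat_def)
qed

lemma submat_mat_1_vector:
  assumes "\<And>j. j \<notin> S \<Longrightarrow> u $ j = 0"
  shows "submat S S (mat 1) *v u = (u :: real^'q)"
proof -
  have "(\<Sum>j\<in>UNIV. submat S S (mat 1 :: real^'q^'q) $ i $ j * u $ j) = (\<Sum>j\<in>{i}. u $ j)" for i
    using assms by (intro sum.mono_neutral_cong_right) (auto simp: submat_def mat_def)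
  then show ?thesis by (simp add: vec_eq_iff matrix_vector_mult_def)
qed

lemma submat_mat_1_mult:
  assumes "submat S T B = (B :: real^'n^'q)"
  shows "submat S S (mat 1) ** B = B"
proof -
  have "(\<Sum>k\<in>UNIV. submat S S (mat 1 :: real^'q^'q) $ i $ k * B $ k $ j) = (\<Sum>k\<in>{i}. B $ k $ j)" for i j
    using submat_fixed_zero[OF assms]
    by (intro sum.mono_neutral_cong_right) (auto simp: submat_def mat_def)
  then show ?thesis by (simp add: vec_eq_iff matrix_matrix_mult_def)
qed

lemma is_submat_inv_submat_inv:
  assumes "submat_invertible S A"
  shows "is_submat_inv S A (submat_inv S A)"
proof -
  obtain B where B: "is_submat_inv S A B" using assms by (auto simp: submat_invertible_def)
  have "B' = B" if B': "is_submat_inv S A B'" for B'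
  proof -
    have "B' = submat S S (mat 1) ** B'"
      using B' submat_mat_1_mult[of S S B'] by (simp add: is_submat_inv_def)
    also have "\<dots> = B ** (submat S S A ** B')"
      using B by (simp add: is_submat_inv_def matrix_mul_assoc)
    also have "submat S S A ** B' = submat S S A ** B"
      using B B' by (simp add: is_submat_inv_def)
    also have "B ** (submat S S A ** B) = (B ** submat S S A) ** B"
      by (rule matrix_mul_assoc)
    also have "\<dots> = B"
      using B submat_mat_1_mult[of S S B] by (simp add: is_submat_inv_def)
    finally show ?thesis .
  qed
  then show ?thesis unfolding submat_inv_def using B by (rule theI[rotated])
qed

lemma submat_mult_vector:
  assumes "\<And>j. j \<notin> S \<Longrightarrow> u $ j = 0" and "i \<in> T"
  shows "(submat T S A *v u) $ i = (A *v u) $ i"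
  unfolding matrix_vector_mult_def using assms
  by (auto simp: submat_def intro!: sum.cong)

text \<open>Only the \<open>S\<close>-block of \<open>\<Gamma>\<close> matters: \<open>u\<close> lives on the columns in \<open>S\<close> and the padded inverse
  ignores the rows outside \<open>S\<close>.\<close>
lemma submat_inv_mult:
  fixes \<Gamma> B :: "real^'q^'q"
  assumes B: "is_submat_inv S \<Gamma> B" and u: "\<And>j. j \<notin> S \<Longrightarrow> u $ j = 0"
  shows "B *v (\<Gamma> *v u) = u"
proof -
  have "B $ i $ k * (\<Gamma> *v u) $ k = B $ i $ k * (submat S S \<Gamma> *v u) $ k" for i k
  proof (cases "k \<in> S")
    case True
    then show ?thesis using submat_mult_vector[of S u k S \<Gamma>] u by simp
  next
    case False
    then show ?thesis using B submat_fixed_zero[of S S B i k] by (simp add: is_submat_inv_def)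
  qed
  then have "B *v (\<Gamma> *v u) = B *v (submat S S \<Gamma> *v u)"
    unfolding vec_eq_iff matrix_vector_mult_def[of B] vec_lambda_beta by (simp only: simp_thms)
  also have "\<dots> = submat S S (mat 1) *v u"
    using B by (simp add: is_submat_inv_def matrix_vector_mul_assoc)
  also have "\<dots> = u" using u by (rule submat_mat_1_vector)
  finally show ?thesis .
qed

text \<open>The matrix of the irrepresentability condition expresses the entries of \<open>\<Gamma> u\<close> outside \<open>S\<close>
  through those inside \<open>S\<close>.\<close>
lemma submat_complement_inv_mult:
  fixes \<Gamma> B :: "real^'q^'q"
  assumes B: "is_submat_inv S \<Gamma> B" and u: "\<And>j. j \<notin> S \<Longrightarrow> u $ j = 0" and j: "j \<notin> S"
  shows "((submat (- S) S \<Gamma> ** B) *v (\<Gamma> *v u)) $ j = (\<Gamma> *v u) $ j"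
  using submat_inv_mult[OF B u] submat_mult_vector[of S u j "- S" \<Gamma>] u j
  by (simp add: matrix_vector_mul_assoc[symmetric])

section \<open>Support recovery by a primal-dual witness\<close>

text \<open>Here \<open>\<Gamma>\<close> is an idealized Gram matrix satisfying irrepresentability, and \<open>\<epsilon>\<close> measures how far the
  actual Gram matrix is from it on vectors supported in \<open>S\<close>. Let \<open>u\<close> be the error of the restricted
  minimizer, \<open>K\<close> its maximum norm and \<open>\<rho>\<close> a bound for the gradient at \<open>mstar\<close>. Stationarity bounds
  \<open>\<Gamma> u\<close> on \<open>S\<close> by \<open>\<epsilon> K + lam + \<rho>\<close>. Applying the inverse gives
  \<open>K \<le> c (\<epsilon> K + lam + \<rho>)\<close>, where \<open>c\<close> is the norm of the inverse and \<open>c \<epsilon> \<le> \<alpha> / 6\<close>, so \<open>K\<close> can be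
  solved for. Applying the irrepresentability matrix instead bounds the gradient
  off \<open>S\<close> by \<open>(1 - \<alpha>) lam + (2 - \<alpha>) (\<epsilon> K + \<rho>)\<close>; each of the two small terms, multiplied by
  \<open>2 - \<alpha>\<close>, uses at most a third of the slack \<open>\<alpha> lam\<close>.\<close>
lemma lasso_support_recovery:
  fixes A :: "real^'q^'m" and \<Gamma> B :: "real^'q^'q" and mstar mhat :: "real^'q"
  assumes lam: "0 < lam" and \<alpha>: "0 < \<alpha>" "\<alpha> \<le> 1"
    and supp: "\<And>j. j \<notin> S \<Longrightarrow> mstar $ j = 0"
    and B: "is_submat_inv S \<Gamma> B"
    and irrep: "row_sum_norm (submat (- S) S \<Gamma> ** B) < 1 - \<alpha>"
    and E: "\<And>u K j. (\<And>j. j \<notin> S \<Longrightarrow> u $ j = 0) \<Longrightarrow> (\<And>j. \<bar>u $ j\<bar> \<le> K) \<Longrightarrow>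
              \<bar>((transpose A ** A) *v u) $ j - (\<Gamma> *v u) $ j\<bar> \<le> \<epsilon> * K"
    and \<epsilon>: "0 \<le> \<epsilon>" "row_sum_norm B * \<epsilon> \<le> \<alpha> / 6"
    and r: "\<And>j. \<bar>lasso_gradient A c mstar $ j\<bar> < \<alpha> / (3 * (2 - \<alpha>)) * lam"
    and mhat: "\<And>m. lasso_objective A c lam mhat \<le> lasso_objective A c lam m"
  shows "\<And>j. j \<notin> S \<Longrightarrow> mhat $ j = 0"
    and "\<And>m. (\<And>m'. lasso_objective A c lam m \<le> lasso_objective A c lam m') \<Longrightarrow> m = mhat"
    and "S \<noteq> {} \<Longrightarrow> \<bar>(mhat - mstar) $ j\<bar> < 2 * row_sum_norm B / (2 - \<alpha>) * lam"
proof -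
  define cB where "cB = row_sum_norm B"
  define \<rho> where "\<rho> = \<alpha> / (3 * (2 - \<alpha>)) * lam"
  have cB: "0 \<le> cB" by (simp add: cB_def row_sum_norm_nonneg)
  have \<rho>: "0 < \<rho>" using \<alpha> lam by (simp add: \<rho>_def)
  have B0: "j \<in> S" if "B $ i $ j \<noteq> 0" for i j
    using B submat_fixed_zero[of S S B i j] that by (auto simp: is_submat_inv_def)
  obtain m where m0: "\<And>j. j \<notin> S \<Longrightarrow> m $ j = 0"
    and m_min: "\<And>m'. (\<And>j. j \<notin> S \<Longrightarrow> m' $ j = 0) \<Longrightarrow> lasso_objective A c lam m \<le> lasso_objective A c lam m'"
    using lasso_restricted_minimizer_exists[OF lam, of S A c] by blast
  have stat: "0 \<le> s * lasso_gradient A c m $ j + lam * (\<bar>m $ j + s\<bar> - \<bar>m $ j\<bar>)" if "j \<in> S" for j s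
    using lasso_stationarity_on_support[OF lam m0 m_min that] by blast
  have g_le: "\<bar>lasso_gradient A c m $ j\<bar> \<le> lam" if "j \<in> S" for j
  proof -
    have "lam * (\<bar>m $ j + s\<bar> - \<bar>m $ j\<bar>) \<le> lam * \<bar>s\<bar>" for s
      using lam by (intro mult_left_mono) auto
    from this[of 1] this[of "-1"] stat[OF that, of 1] stat[OF that, of "-1"]
    show ?thesis by (simp add: abs_le_iff)
  qed
  define u where "u = m - mstar"
  have u0: "u $ j = 0" if "j \<notin> S" for j using m0[OF that] supp[OF that] by (simp add: u_def)
  have grad: "lasso_gradient A c m = (transpose A ** A) *v u + lasso_gradient A c mstar"
    by (simp add: lasso_gradient_def u_def matrix_vector_mul_assoc[symmetric]
        matrix_vector_mult_diff_distrib matrix_vector_right_distrib algebra_simps)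
  \<comment> \<open>inverting \<open>\<Gamma>\<close> on \<open>S\<close>; used for the error of the minimizer and for injectivity of \<open>A\<close>\<close>
  have contract: "K \<le> cB * (\<epsilon> * K + b)"
    if v0: "\<And>j. j \<notin> S \<Longrightarrow> v $ j = 0" and K: "\<And>j. \<bar>v $ j\<bar> \<le> K" and k: "K = \<bar>v $ k\<bar>"
      and b: "0 \<le> b" "\<And>j. j \<in> S \<Longrightarrow> \<bar>((transpose A ** A) *v v) $ j\<bar> \<le> b" for v K b k
  proof -
    have K0: "0 \<le> K" using k by simp
    have "K = \<bar>(B *v (\<Gamma> *v v)) $ k\<bar>" using k submat_inv_mult[OF B v0] by simp
    also have "\<dots> \<le> row_sum_norm B * (\<epsilon> * K + b)"
    proof (rule row_sum_norm_bound)
      show "\<bar>(\<Gamma> *v v) $ j\<bar> \<le> \<epsilon> * K + b" if "B $ k $ j \<noteq> 0" for j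
        using b(2)[OF B0[OF that]] E[OF v0 K, of j] by linarith
      show "0 \<le> \<epsilon> * K + b" using K0 \<epsilon> b by simp
    qed
    finally show ?thesis by (simp add: cB_def)
  qed
  have max_entry: "\<exists>k. \<forall>j. \<bar>v $ j\<bar> \<le> \<bar>v $ k\<bar>" for v :: "real^'q"
  proof -
    obtain k where "is_arg_min (\<lambda>j. - \<bar>v $ j\<bar>) (\<lambda>j. j \<in> UNIV) k"
      using ex_is_arg_min_if_finite[of UNIV "\<lambda>j. - \<bar>v $ j\<bar>"] by auto
    then show ?thesis by (auto simp: is_arg_min_linorder)
  qed
  have inj: "v = 0" if v0: "\<And>j. j \<notin> S \<Longrightarrow> v $ j = 0" and Av: "A *v v = 0" for v
  proof -
    obtain k where k: "\<And>j. \<bar>v $ j\<bar> \<le> \<bar>v $ k\<bar>" using max_entry by blast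
    have "\<bar>v $ k\<bar> \<le> cB * (\<epsilon> * \<bar>v $ k\<bar> + 0)"
      using Av by (intro contract[OF v0 k]) (auto simp: matrix_vector_mul_assoc[symmetric])
    also have "\<dots> = (cB * \<epsilon>) * \<bar>v $ k\<bar>" by simp
    also have "\<dots> \<le> (\<alpha> / 6) * \<bar>v $ k\<bar>" using \<epsilon> by (intro mult_right_mono) (auto simp: cB_def)
    also have "\<dots> \<le> (1 / 6) * \<bar>v $ k\<bar>" using \<alpha> by (intro mult_right_mono) auto
    finally have "v $ k = 0" by simp
    then show "v = 0" using k by (simp add: vec_eq_iff)
  qed
  obtain k where k: "\<And>j. \<bar>u $ j\<bar> \<le> \<bar>u $ k\<bar>" using max_entry by blast
  define K where "K = \<bar>u $ k\<bar>"
  have K: "\<bar>u $ j\<bar> \<le> K" for j using k by (simp add: K_def)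
  \<comment> \<open>the maximum, strictly below \<open>\<rho>\<close>, keeps the final error bound strict\<close>
  define \<rho>' where "\<rho>' = Max (range (\<lambda>j. \<bar>lasso_gradient A c mstar $ j\<bar>))"
  have \<rho>': "\<rho>' < \<rho>" "\<bar>lasso_gradient A c mstar $ j\<bar> \<le> \<rho>'" for j
    using r by (auto simp: \<rho>'_def \<rho>_def)
  have \<rho>'0: "0 \<le> \<rho>'" using \<rho>'(2) by (meson abs_ge_zero order_trans)
  have K_le: "K \<le> cB * (\<epsilon> * K + (lam + \<rho>'))"
  proof (rule contract[OF u0 K K_def])
    show "0 \<le> lam + \<rho>'" using lam \<rho>'0 by simp
    show "\<bar>((transpose A ** A) *v u) $ j\<bar> \<le> lam + \<rho>'" if "j \<in> S" for j
      using g_le[OF that] \<rho>'(2)[of j] by (simp add: grad abs_le_iff)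
  qed
  \<comment> \<open>the term \<open>\<epsilon> K\<close> is absorbed on the left because \<open>cB \<epsilon> \<le> \<alpha> / 6\<close>\<close>
  have K_bound: "K * (6 - \<alpha>) \<le> cB * (6 * (lam + \<rho>'))"
  proof -
    have "cB * \<epsilon> * K \<le> \<alpha> / 6 * K"
      using \<epsilon> by (intro mult_right_mono) (auto simp: cB_def K_def)
    with K_le show ?thesis by (simp add: algebra_simps)
  qed
  have lam\<rho>: "6 * (lam + \<rho>) \<le> (6 - \<alpha>) * (2 * lam / (2 - \<alpha>))"
    using \<alpha> lam by (simp add: \<rho>_def field_simps)
  have K_le2: "K \<le> 2 * cB / (2 - \<alpha>) * lam"
  proof -
    have "K * (6 - \<alpha>) \<le> cB * (6 * (lam + \<rho>'))" by (rule K_bound)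
    also have "\<dots> \<le> cB * (6 * (lam + \<rho>))" using \<rho>' cB by (intro mult_left_mono) auto
    also have "\<dots> \<le> cB * ((6 - \<alpha>) * (2 * lam / (2 - \<alpha>)))" using lam\<rho> cB by (intro mult_left_mono) auto
    also have "\<dots> = (2 * cB / (2 - \<alpha>) * lam) * (6 - \<alpha>)" by simp
    finally show ?thesis by (rule mult_right_le_imp_le) (use \<alpha> in simp)
  qed
  have K_less: "K < 2 * cB / (2 - \<alpha>) * lam" if ne: "S \<noteq> {}"
  proof -
    obtain s where s: "s \<in> S" using ne by auto
    \<comment> \<open>strictness needs a nonzero inverse, which a nonempty \<open>S\<close> provides\<close>
    have "cB \<noteq> 0"
    proof
      assume "cB = 0"
      have "\<bar>(B *v (\<Gamma> *v axis s 1)) $ s\<bar> \<le> row_sum_norm B * Max (range (\<lambda>j. \<bar>(\<Gamma> *v axis s 1) $ j\<bar>))"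
        by (intro row_sum_norm_bound) (auto simp: Max_ge_iff)
      also have "B *v (\<Gamma> *v axis s 1) = axis s 1"
        using s by (intro submat_inv_mult[OF B]) (auto simp: axis_def)
      finally show False using \<open>cB = 0\<close> by (simp add: cB_def)
    qed
    with cB have "0 < cB" by simp
    have "K * (6 - \<alpha>) \<le> cB * (6 * (lam + \<rho>'))" by (rule K_bound)
    also have "\<dots> < cB * (6 * (lam + \<rho>))" using \<rho>' \<open>0 < cB\<close> by (intro mult_strict_left_mono) auto
    also have "\<dots> \<le> cB * ((6 - \<alpha>) * (2 * lam / (2 - \<alpha>)))" using lam\<rho> cB by (intro mult_left_mono) auto
    also have "\<dots> = (2 * cB / (2 - \<alpha>) * lam) * (6 - \<alpha>)" by simp
    finally show ?thesis by (rule mult_right_less_imp_less) (use \<alpha> in simp)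
  qed
  have strict: "\<bar>lasso_gradient A c m $ j\<bar> < lam" if j: "j \<notin> S" for j
  proof -
    let ?D = "submat (- S) S \<Gamma> ** B"
    define b where "b = \<epsilon> * K + \<rho>'"
    have b0: "0 \<le> b" using \<epsilon> \<rho>'0 by (simp add: b_def K_def)
    have "\<bar>(\<Gamma> *v u) $ j\<bar> = \<bar>(?D *v (\<Gamma> *v u)) $ j\<bar>"
      by (rule arg_cong[where f = abs], rule sym, rule submat_complement_inv_mult[OF B _ j]) (rule u0)
    also have "\<dots> \<le> row_sum_norm ?D * (lam + b)"
    proof (rule row_sum_norm_bound)
      fix i assume "?D $ j $ i \<noteq> 0"
      then have i: "i \<in> S"
        using B0 by (force simp: matrix_matrix_mult_def intro: sum.neutral)
      show "\<bar>(\<Gamma> *v u) $ i\<bar> \<le> lam + b"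
        using g_le[OF i] \<rho>'(2)[of i] E[OF u0 K, of i] by (simp add: grad b_def abs_le_iff)
    qed (use lam b0 in simp)
    also have "\<dots> \<le> (1 - \<alpha>) * (lam + b)" using irrep lam b0 by (intro mult_right_mono) auto
    finally have "\<bar>lasso_gradient A c m $ j\<bar> \<le> (1 - \<alpha>) * (lam + b) + b"
      using \<rho>'(2)[of j] E[OF u0 K, of j] by (simp add: grad b_def abs_le_iff)
    also have "\<dots> = (1 - \<alpha>) * lam + (2 - \<alpha>) * b" by (simp add: algebra_simps)
    also have "(2 - \<alpha>) * b < \<alpha> * lam"
    proof -
      have "(2 - \<alpha>) * (\<epsilon> * K) \<le> (2 - \<alpha>) * (\<epsilon> * (2 * cB / (2 - \<alpha>) * lam))"
        using K_le2 \<epsilon> \<alpha> by (intro mult_left_mono) auto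
      also have "\<dots> = 2 * lam * (cB * \<epsilon>)" using \<alpha> by simp
      also have "\<dots> \<le> 2 * lam * (\<alpha> / 6)" using \<epsilon> lam by (intro mult_left_mono) (auto simp: cB_def)
      finally have 1: "(2 - \<alpha>) * (\<epsilon> * K) \<le> \<alpha> * lam / 3" by simp
      have "(2 - \<alpha>) * \<rho>' < (2 - \<alpha>) * \<rho>" using \<rho>' \<alpha> by (intro mult_strict_left_mono) auto
      also have "\<dots> = \<alpha> * lam / 3" using \<alpha> by (simp add: \<rho>_def divide_simps)
      finally have 2: "(2 - \<alpha>) * \<rho>' < \<alpha> * lam / 3" .
      have "0 < \<alpha> * lam" using \<alpha> lam by simp
      with 1 2 show ?thesis by (simp add: b_def algebra_simps)
    qed
    finally show ?thesis by (simp add: algebra_simps)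
  qed
  have unique: "m' = m" if "lasso_objective A c lam m' \<le> lasso_objective A c lam m" for m'
    by (rule lasso_minimizer_unique_if_dual_certificate[OF stat m0 strict inj that])
  have mhat_eq: "mhat = m" using unique mhat by blast
  show "mhat $ j = 0" if "j \<notin> S" for j using m0 that mhat_eq by simp
  show "m' = mhat" if "\<And>m''. lasso_objective A c lam m' \<le> lasso_objective A c lam m''" for m'
    using unique that mhat_eq by blast
  show "\<bar>(mhat - mstar) $ j\<bar> < 2 * row_sum_norm B / (2 - \<alpha>) * lam" if "S \<noteq> {}"
    using K_less[OF that] K[of j] by (simp add: mhat_eq u_def cB_def)
qed

section \<open>Perturbation bounds for the Lyapunov operator\<close>

lemma norm_matrix_power2: "(norm (M :: real^'n^'m))\<^sup>2 = (\<Sum>i\<in>UNIV. (norm (M $ i))\<^sup>2)"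
  by (simp add: norm_vec_def L2_set_def sum_nonneg)

lemma norm_matrix_entries: "(norm (M :: real^'n^'m))\<^sup>2 = (\<Sum>i\<in>UNIV. \<Sum>j\<in>UNIV. (M $ i $ j)\<^sup>2)"
  unfolding norm_matrix_power2 by (simp add: norm_vec_def L2_set_def sum_nonneg)

lemma norm_vectorize: "norm (vectorize M) = norm M"
proof -
  have "(norm (vectorize M))\<^sup>2 = (\<Sum>r\<in>UNIV. (M $ fst r $ snd r)\<^sup>2)"
    by (simp add: norm_vec_def L2_set_def sum_nonneg vectorize_def)
  also have "\<dots> = (\<Sum>i\<in>UNIV. \<Sum>j\<in>UNIV. (M $ i $ j)\<^sup>2)"
    by (simp add: sum.cartesian_product case_prod_beta)
  also have "\<dots> = (norm M)\<^sup>2" by (rule norm_matrix_entries[symmetric])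
  finally show ?thesis by simp
qed

lemma norm_transpose: "norm (transpose M) = norm (M :: real^'n^'m)"
proof -
  have "(norm (transpose M))\<^sup>2 = (norm M)\<^sup>2"
    unfolding norm_matrix_entries transpose_def vec_lambda_beta by (rule sum.swap)
  then show ?thesis by simp
qed

lemma spectral_norm_bound: "norm (A *v x) \<le> spectral_norm A * norm x"
  unfolding spectral_norm_def by (rule onorm) (rule matrix_vector_mul_bounded_linear)

lemma spectral_norm_nonneg: "0 \<le> spectral_norm A"
  unfolding spectral_norm_def by (rule onorm_pos_le) (rule matrix_vector_mul_bounded_linear)

lemma spectral_norm_triangle: "spectral_norm (A + B) \<le> spectral_norm A + spectral_norm B"
  unfolding spectral_norm_def matrix_vector_mult_add_rdistrib
  by (intro onorm_triangle matrix_vector_mul_bounded_linear)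

text \<open>For symmetric \<open>\<Sigma>\<close> the rows of the product are the images under \<open>\<Sigma>\<close> of the rows of \<open>M\<close>, so the
  bound holds row by row.\<close>
lemma norm_mult_symmetric_le:
  fixes M :: "real^'p^'p"
  assumes "transpose \<Sigma> = \<Sigma>"
  shows "norm (M ** \<Sigma>) \<le> spectral_norm \<Sigma> * norm M"
proof -
  have sym: "\<Sigma> $ i $ j = \<Sigma> $ j $ i" for i j
    using assms by (metis transpose_def vec_lambda_beta)
  have row: "(M ** \<Sigma>) $ i = \<Sigma> *v (M $ i)" for i
    by (subst vec_eq_iff) (simp add: matrix_matrix_mult_def matrix_vector_mult_def sym mult.commute)
  have "(norm (M ** \<Sigma>))\<^sup>2 = (\<Sum>i\<in>UNIV. (norm (\<Sigma> *v (M $ i)))\<^sup>2)"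
    by (simp add: norm_matrix_power2 row)
  also have "\<dots> \<le> (\<Sum>i\<in>UNIV. (spectral_norm \<Sigma> * norm (M $ i))\<^sup>2)"
    by (intro sum_mono power_mono spectral_norm_bound norm_ge_zero)
  also have "\<dots> = (spectral_norm \<Sigma> * norm M)\<^sup>2"
    by (simp add: norm_matrix_power2 power_mult_distrib sum_distrib_left)
  finally show ?thesis
    by (rule power2_le_imp_le) (simp add: spectral_norm_nonneg)
qed

lemma vectorize_surj: obtains M where "x = vectorize M"
  by (rule that[of "\<chi> j k. x $ (j, k)"]) (simp add: vectorize_def vec_eq_iff)

text \<open>The two summands of \<open>M \<Sigma> + \<Sigma> M\<^sup>T\<close> are transposes of each other.\<close>
lemma lyap_matrix_norm_le:
  assumes "transpose \<Sigma> = \<Sigma>"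
  shows "norm (lyap_matrix \<Sigma> *v x) \<le> 2 * spectral_norm \<Sigma> * norm x"
proof -
  obtain M where M: "x = vectorize M" by (rule vectorize_surj)
  have "\<Sigma> ** transpose M = transpose (M ** \<Sigma>)" using assms by (simp add: matrix_transpose_mul)
  then have "norm (lyap_matrix \<Sigma> *v x) \<le> norm (M ** \<Sigma>) + norm (M ** \<Sigma>)"
    using norm_triangle_ineq[of "M ** \<Sigma>" "transpose (M ** \<Sigma>)"] assms
    by (simp add: M lyap_matrix_vectorize norm_vectorize norm_transpose)
  also have "\<dots> \<le> 2 * spectral_norm \<Sigma> * norm x"
    using norm_mult_symmetric_le[OF assms, of M] by (simp add: M norm_vectorize)
  finally show ?thesis .
qed

lemma lyap_matrix_add: "lyap_matrix (\<Sigma> + \<Delta>) = lyap_matrix \<Sigma> + lyap_matrix \<Delta>"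
proof -
  have "kron (\<Sigma> + \<Delta>) B = kron \<Sigma> B + kron \<Delta> B" "kron B (\<Sigma> + \<Delta>) = kron B \<Sigma> + kron B \<Delta>" for B
    by (simp_all add: kron_def vec_eq_iff algebra_simps)
  moreover have "(A + B) ** L = A ** L + B ** L" for A B L :: "real^('a \<times> 'a)^('a \<times> 'a)"
    by (simp add: matrix_matrix_mult_def vec_eq_iff distrib_right sum.distrib)
  ultimately show ?thesis by (simp add: lyap_matrix_def)
qed

lemma transpose_mult_component:
  "(transpose A *v x) $ j = (A *v axis j 1) \<bullet> (x :: real^'m)" for A :: "real^'n^'m"
proof -
  have "(transpose A *v x) $ j = (transpose A *v x) \<bullet> axis j 1"
    by (simp add: cart_eq_inner_axis)
  also have "\<dots> = x \<bullet> (A *v axis j 1)" by (simp add: dot_lmul_matrix)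
  finally show ?thesis by (simp add: inner_commute)
qed

lemma norm_le_sqrt_card_support:
  fixes u :: "real^'n"
  assumes supp: "\<And>j. j \<notin> S \<Longrightarrow> u $ j = 0" and K: "\<And>j. \<bar>u $ j\<bar> \<le> K"
  shows "norm u \<le> sqrt (card S) * K"
proof -
  have K0: "0 \<le> K" using K[of undefined] by linarith
  have "(norm u)\<^sup>2 = (\<Sum>j\<in>UNIV. (u $ j)\<^sup>2)" by (simp add: norm_vec_def L2_set_def sum_nonneg)
  also have "\<dots> = (\<Sum>j\<in>S. (u $ j)\<^sup>2)" using supp by (intro sum.mono_neutral_right) auto
  also have "\<dots> \<le> (\<Sum>j\<in>S. K\<^sup>2)"
    using K by (intro sum_mono) (metis abs_ge_zero power2_abs power_mono)
  also have "\<dots> = (sqrt (card S) * K)\<^sup>2" by (simp add: power_mult_distrib)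
  finally show ?thesis by (rule power2_le_imp_le) (simp add: K0)
qed

text \<open>Entry \<open>j\<close> of \<open>A\<^sup>T A u\<close> is the inner product of \<open>A e\<close> and \<open>A u\<close>, where \<open>e\<close> is the unit vector at
  \<open>j\<close>. Expanding \<open>A(\<Sigma>) + A(\<Delta>)\<close> in both factors leaves three terms that contain \<open>\<Delta>\<close>; Cauchy-Schwarz
  bounds each of them by the Euclidean norm of \<open>u\<close>, which costs the factor \<open>sqrt (card S)\<close>
  against the maximum norm.\<close>
lemma gram_matrix_perturbation:
  fixes u :: "real^('p::finite \<times> 'p)" and \<Sigma> \<Delta> :: "real^'p^'p"
  assumes \<Sigma>: "transpose \<Sigma> = \<Sigma>" and \<Delta>: "transpose \<Delta> = \<Delta>"
    and supp: "\<And>j. j \<notin> S \<Longrightarrow> u $ j = 0" and K: "\<And>j. \<bar>u $ j\<bar> \<le> K"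
  shows "\<bar>(gram_matrix (\<Sigma> + \<Delta>) *v u) $ j - (gram_matrix \<Sigma> *v u) $ j\<bar>
     \<le> (4 * spectral_norm \<Delta> + 8 * spectral_norm \<Sigma>) * spectral_norm \<Delta> * sqrt (card S) * K"
proof -
  let ?A = "lyap_matrix \<Sigma>" and ?D = "lyap_matrix \<Delta>" and ?e = "axis j 1 :: real^('p \<times> 'p)"
  let ?s = "spectral_norm \<Sigma>" and ?t = "spectral_norm \<Delta>"
  have e: "norm (lyap_matrix M *v ?e) \<le> 2 * spectral_norm M" if "transpose M = M" for M :: "real^'p^'p"
    using lyap_matrix_norm_le[OF that, of ?e] by simp
  have cs: "\<bar>(lyap_matrix M *v ?e) \<bullet> (lyap_matrix N *v u)\<bar> \<le> (2 * spectral_norm M) * (2 * spectral_norm N * norm u)"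
    if "transpose M = M" "transpose N = N" for M N :: "real^'p^'p"
    using Cauchy_Schwarz_ineq2[of "lyap_matrix M *v ?e" "lyap_matrix N *v u"]
      mult_mono[OF e[OF that(1)] lyap_matrix_norm_le[OF that(2), of u]] spectral_norm_nonneg[of M]
    by (simp add: mult.assoc)
  have gram: "(gram_matrix M *v u) $ j = (lyap_matrix M *v ?e) \<bullet> (lyap_matrix M *v u)" for M :: "real^'p^'p"
    unfolding gram_matrix_def matrix_vector_mul_assoc[symmetric] transpose_mult_component ..
  have "(gram_matrix (\<Sigma> + \<Delta>) *v u) $ j - (gram_matrix \<Sigma> *v u) $ j
      = (?D *v ?e) \<bullet> (?D *v u) + (?D *v ?e) \<bullet> (?A *v u) + (?A *v ?e) \<bullet> (?D *v u)"
    unfolding gram lyap_matrix_add matrix_vector_mult_add_rdistrib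
    by (simp add: inner_add_left inner_add_right)
  then have "\<bar>(gram_matrix (\<Sigma> + \<Delta>) *v u) $ j - (gram_matrix \<Sigma> *v u) $ j\<bar>
      \<le> (4 * ?t + 8 * ?s) * ?t * norm u"
    using cs[OF \<Delta> \<Delta>] cs[OF \<Delta> \<Sigma>] cs[OF \<Sigma> \<Delta>] by (simp add: algebra_simps)
  also have "\<dots> \<le> (4 * ?t + 8 * ?s) * ?t * (sqrt (card S) * K)"
    using norm_le_sqrt_card_support[OF supp K]
    by (intro mult_left_mono) (auto simp: spectral_norm_nonneg)
  finally show ?thesis by (simp add: mult.assoc)
qed

text \<open>By the Lyapunov equation the residual at \<open>M\<close> is \<open>A(\<Delta>) vec M\<close>, so the gradient is of first order
  in \<open>\<Delta>\<close> and scales with \<open>M\<close>; the volatility matrix \<open>C\<close> has cancelled.\<close>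
lemma lyap_gradient_at_truth:
  fixes M C \<Sigma> \<Delta> :: "real^'p^'p"
  assumes \<Sigma>: "transpose \<Sigma> = \<Sigma>" and \<Delta>: "transpose \<Delta> = \<Delta>"
    and eq: "M ** \<Sigma> + \<Sigma> ** transpose M + C = 0"
  shows "\<bar>lasso_gradient (lyap_matrix (\<Sigma> + \<Delta>)) (vectorize C) (vectorize M) $ j\<bar>
     \<le> 4 * (spectral_norm \<Sigma> + spectral_norm \<Delta>) * spectral_norm \<Delta> * norm M"
proof -
  let ?A = "lyap_matrix (\<Sigma> + \<Delta>)" and ?D = "lyap_matrix \<Delta>" and ?e = "axis j 1 :: real^('p \<times> 'p)"
  have sym: "transpose (\<Sigma> + \<Delta>) = \<Sigma> + \<Delta>"
    using \<Sigma> \<Delta> by (simp add: transpose_def vec_eq_iff)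
  have "lyap_matrix \<Sigma> *v vectorize M + vectorize C = vectorize (M ** \<Sigma> + \<Sigma> ** transpose M + C)"
    unfolding lyap_matrix_vectorize[OF \<Sigma>] by (simp add: vectorize_def vec_eq_iff)
  then have "lyap_matrix \<Sigma> *v vectorize M + vectorize C = 0"
    unfolding eq by (simp add: vectorize_def vec_eq_iff)
  then have "?A *v vectorize M + vectorize C = ?D *v vectorize M"
    unfolding lyap_matrix_add matrix_vector_mult_add_rdistrib by (simp add: algebra_simps)
  then have "lasso_gradient ?A (vectorize C) (vectorize M) $ j = (?A *v ?e) \<bullet> (?D *v vectorize M)"
    unfolding lasso_gradient_def by (simp only: transpose_mult_component)
  also have "\<bar>\<dots>\<bar> \<le> norm (?A *v ?e) * norm (?D *v vectorize M)" by (rule Cauchy_Schwarz_ineq2)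
  also have "\<dots> \<le> (2 * (spectral_norm \<Sigma> + spectral_norm \<Delta>)) * (2 * spectral_norm \<Delta> * norm M)"
  proof (rule mult_mono)
    have "norm (?A *v ?e) \<le> 2 * spectral_norm (\<Sigma> + \<Delta>)"
      using lyap_matrix_norm_le[OF sym, of ?e] by simp
    then show "norm (?A *v ?e) \<le> 2 * (spectral_norm \<Sigma> + spectral_norm \<Delta>)"
      using spectral_norm_triangle[of \<Sigma> \<Delta>] by simp
    show "norm (?D *v vectorize M) \<le> 2 * spectral_norm \<Delta> * norm M"
      using lyap_matrix_norm_le[OF \<Delta>, of "vectorize M"] by (simp add: norm_vectorize)
  qed (auto simp: spectral_norm_nonneg)
  finally show ?thesis by (simp add: algebra_simps)
qed

lemma lyap_lasso_objective_vectorize: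
  assumes "transpose \<Sigma> = \<Sigma>"
  shows "lyap_lasso_objective C lam \<Sigma> M
     = lasso_objective (lyap_matrix \<Sigma>) (vectorize C) lam (vectorize M)"
proof -
  have "lyap_matrix \<Sigma> *v vectorize M + vectorize C = vectorize (M ** \<Sigma> + \<Sigma> ** transpose M + C)"
    unfolding lyap_matrix_vectorize[OF assms] by (simp add: vectorize_def vec_eq_iff)
  moreover have "entry_norm1 M = (\<Sum>r\<in>UNIV. \<bar>vectorize M $ r\<bar>)"
    by (simp add: entry_norm1_def vectorize_def sum.cartesian_product case_prod_beta)
  ultimately show ?thesis
    by (simp add: lyap_lasso_objective_def lasso_objective_def norm_vectorize)
qed

section \<open>Moments of the centered Gaussian law\<close>

lemma nn_integral_lborel_affine:
  fixes f :: "'a::euclidean_space \<Rightarrow> ennreal"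
  assumes [measurable]: "f \<in> borel_measurable borel" and c: "\<bar>c\<bar> = 1"
  shows "(\<integral>\<^sup>+x. f (t + c *\<^sub>R x) \<partial>lborel) = (\<integral>\<^sup>+x. f x \<partial>lborel)"
proof -
  have "lborel = distr lborel borel (\<lambda>x::'a. t + c *\<^sub>R x)"
    using lborel_affine[of c t] c by (auto simp: density_1 simp flip: one_ennreal_def)
  then have "(\<integral>\<^sup>+x. f x \<partial>lborel) = (\<integral>\<^sup>+x. f x \<partial>distr lborel borel (\<lambda>x::'a. t + c *\<^sub>R x))"
    by simp
  also have "\<dots> = (\<integral>\<^sup>+x. f (t + c *\<^sub>R x) \<partial>lborel)" by (rule nn_integral_distr) auto
  finally show ?thesis by simp
qed

text \<open>The second difference quotients at 0 of the moment generating function, with step \<open>1 / Suc n\<close>,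
  converge to \<open>s\<close>. Inside the integral they converge to the square of \<open>Y\<close> and, being of the form
  \<open>k\<^sup>2 (exp w - exp (- w))\<^sup>2\<close> with \<open>w = Y / (2 k)\<close>, are dominated by exponentials of \<open>Y\<close>.\<close>
lemma second_moment_from_gaussian_mgf:
  fixes Y :: "'a \<Rightarrow> real"
  assumes [measurable]: "Y \<in> borel_measurable M" and M: "prob_space M"
    and mgf: "\<And>t. has_bochner_integral M (\<lambda>x. exp (t * Y x)) (exp (t\<^sup>2 * s / 2))"
  shows "has_bochner_integral M (\<lambda>x. (Y x)\<^sup>2) s"
proof -
  interpret prob_space M by fact
  define g where "g n x = (real (Suc n))\<^sup>2 * (exp (Y x / real (Suc n)) + exp (- Y x / real (Suc n)) - 2)" for n x
  have int: "integrable M (\<lambda>x. exp (t * Y x))" for t using mgf by (auto simp: has_bochner_integral_iff)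
  have val: "(\<integral>x. exp (t * Y x) \<partial>M) = exp (t\<^sup>2 * s / 2)" for t using mgf by (auto simp: has_bochner_integral_iff)
  have g_eq: "g n = (\<lambda>x. (real (Suc n))\<^sup>2 * (exp ((1 / real (Suc n)) * Y x) + exp ((- 1 / real (Suc n)) * Y x) - 2))" for n
    by (auto simp: g_def)
  have g_int: "(\<integral>x. g n x \<partial>M) = (real (Suc n))\<^sup>2 * (2 * exp ((1 / real (Suc n))\<^sup>2 * s / 2) - 2)" for n
    unfolding g_eq by (simp only: integral_mult_right_zero Bochner_Integration.integral_diff
      Bochner_Integration.integral_add int val integrable_const Bochner_Integration.integrable_add)
      (simp add: prob_space)
  have lim: "(\<lambda>n. g n x) \<longlonglongrightarrow> (Y x)\<^sup>2" for x
    unfolding g_def by (real_asymp simp: power2_eq_square)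
  \<comment> \<open>from \<open>1 - exp (- 2 w) \<le> 2 w\<close> for nonnegative \<open>w\<close>, and symmetry in \<open>w\<close>\<close>
  have sinh_bound: "(exp w - exp (- w))\<^sup>2 \<le> 4 * w\<^sup>2 * exp (2 * \<bar>w\<bar>)" for w :: real
  proof -
    have pos: "(exp w - exp (- w))\<^sup>2 \<le> 4 * w\<^sup>2 * exp (2 * \<bar>w\<bar>)" if w: "0 \<le> w" for w :: real
    proof -
      have "exp w - exp (- w) = exp w * (1 - exp (- 2 * w))"
        by (simp add: algebra_simps flip: exp_add)
      also have "\<dots> \<le> exp w * (2 * w)"
        using exp_ge_add_one_self[of "- 2 * w"] by (intro mult_left_mono) auto
      finally have "(exp w - exp (- w))\<^sup>2 \<le> (exp w * (2 * w))\<^sup>2"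
        using w by (intro power_mono) auto
      moreover have "exp (2 * w) = exp w * exp w" by (simp flip: exp_add)
      ultimately show ?thesis using w by (simp add: power2_eq_square mult_ac)
    qed
    show ?thesis
      using pos[of w] pos[of "- w"] by (cases "0 \<le> w") (auto simp: power2_commute)
  qed
  have bound: "norm (g n x) \<le> 2 * (exp (2 * Y x) + exp (- 2 * Y x))" for n x
  proof -
    define k where "k = real (Suc n)"
    have k: "1 \<le> k" by (simp add: k_def)
    define w where "w = Y x / (2 * k)"
    have g: "g n x = k\<^sup>2 * (exp w - exp (- w))\<^sup>2"
    proof -
      have "exp (Y x / k) = exp w * exp w" "exp (- Y x / k) = exp (- w) * exp (- w)" "exp w * exp (- w) = 1"
        using k by (simp_all add: w_def field_simps flip: exp_add)
      then have "(exp w - exp (- w))\<^sup>2 = exp (Y x / k) + exp (- Y x / k) - 2"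
        by (simp add: power2_eq_square algebra_simps)
      then show ?thesis unfolding g_def k_def[symmetric] by simp
    qed
    have "norm (g n x) = k\<^sup>2 * (exp w - exp (- w))\<^sup>2" unfolding g by simp
    also have "\<dots> \<le> k\<^sup>2 * (4 * w\<^sup>2 * exp (2 * \<bar>w\<bar>))"
      by (intro mult_left_mono sinh_bound) simp
    also have "\<dots> = (Y x)\<^sup>2 * exp (\<bar>Y x\<bar> / k)"
      using k by (simp add: w_def power_divide power_mult_distrib abs_divide)
    also have "\<dots> \<le> (2 * exp \<bar>Y x\<bar>) * exp \<bar>Y x\<bar>"
    proof (rule mult_mono)
      show "(Y x)\<^sup>2 \<le> 2 * exp \<bar>Y x\<bar>"
        using exp_lower_Taylor_quadratic[of "\<bar>Y x\<bar>"] by simp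
      show "exp (\<bar>Y x\<bar> / k) \<le> exp \<bar>Y x\<bar>"
        using k mult_left_mono[OF k, of "\<bar>Y x\<bar>"] by (simp add: divide_le_eq)
    qed auto
    also have "\<dots> = 2 * exp (2 * \<bar>Y x\<bar>)" by (simp flip: exp_add)
    also have "\<dots> \<le> 2 * (exp (2 * Y x) + exp (- 2 * Y x))" by (simp add: abs_if)
    finally show ?thesis .
  qed
  have dom: "integrable M (\<lambda>x. 2 * (exp (2 * Y x) + exp (- 2 * Y x)))"
    using int[of 2] int[of "- 2"] by simp
  have [measurable]: "g n \<in> borel_measurable M" for n unfolding g_eq by measurable
  have "integrable M (\<lambda>x. (Y x)\<^sup>2)"
    by (rule integrable_dominated_convergence[OF _ _ dom, of _ g]) (use lim bound in auto)
  moreover have "(\<lambda>n. \<integral>x. g n x \<partial>M) \<longlonglongrightarrow> (\<integral>x. (Y x)\<^sup>2 \<partial>M)"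
    by (rule integral_dominated_convergence[OF _ _ dom]) (use lim bound in auto)
  moreover have "(\<lambda>n. \<integral>x. g n x \<partial>M) \<longlonglongrightarrow> s" unfolding g_int by real_asymp
  ultimately show ?thesis by (auto simp: has_bochner_integral_iff intro: LIMSEQ_unique)
qed

lemma pos_def_invertible:
  assumes "pos_def \<Sigma>" shows "invertible \<Sigma>"
proof -
  have "x = 0" if "\<Sigma> *v x = 0" for x
    using assms that unfolding pos_def_def by (metis inner_zero_right less_irrefl)
  then show ?thesis
    using matrix_left_invertible_ker[of \<Sigma>] by (auto simp: invertible_left_inverse)
qed

lemma matrix_inv_left: "invertible M \<Longrightarrow> matrix_inv M ** M = mat 1"
  unfolding invertible_def matrix_inv_def by (rule someI2_ex) auto

lemma symmetric_matrix_inv: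
  fixes \<Sigma> :: "real^'n^'n"
  assumes "invertible \<Sigma>" "transpose \<Sigma> = \<Sigma>"
  shows "transpose (matrix_inv \<Sigma>) = matrix_inv \<Sigma>"
proof -
  have "\<Sigma> ** transpose (matrix_inv \<Sigma>) = transpose (matrix_inv \<Sigma> ** \<Sigma>)"
    using assms by (simp add: matrix_transpose_mul)
  also have "\<dots> = mat 1" using assms by (simp add: matrix_inv_left transpose_mat)
  finally have "matrix_inv \<Sigma> ** (\<Sigma> ** transpose (matrix_inv \<Sigma>)) = matrix_inv \<Sigma>" by simp
  then show ?thesis using assms by (simp add: matrix_mul_assoc matrix_inv_left)
qed

definition gaussian_density :: "real^'p^'p \<Rightarrow> real^'p \<Rightarrow> real" where
  "gaussian_density \<Sigma> x = exp (- (x \<bullet> (matrix_inv \<Sigma> *v x)) / 2) / sqrt ((2 * pi) ^ CARD('p) * det \<Sigma>)"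

lemma centered_gaussian_density:
  "centered_gaussian \<Sigma> = density lborel (\<lambda>x. ennreal (gaussian_density \<Sigma> x))"
  by (simp add: centered_gaussian_def gaussian_density_def)

lemma gaussian_density_measurable [measurable]: "gaussian_density \<Sigma> \<in> borel_measurable borel"
  unfolding gaussian_density_def
  by (intro borel_measurable_divide borel_measurable_const borel_measurable_continuous_onI
      continuous_intros matrix_vector_mult_linear_continuous_on) simp

text \<open>Completing the square with centre \<open>\<Sigma> u\<close>.\<close>
lemma gaussian_density_tilt:
  assumes "pos_def \<Sigma>"
  shows "gaussian_density \<Sigma> x * exp (u \<bullet> x)
    = exp (u \<bullet> (\<Sigma> *v u) / 2) * gaussian_density \<Sigma> (- (\<Sigma> *v u) + 1 *\<^sub>R x)"
proof -
  let ?K = "matrix_inv \<Sigma>"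
  have inv: "invertible \<Sigma>" and sym: "transpose \<Sigma> = \<Sigma>"
    using assms pos_def_invertible by (auto simp: pos_def_def)
  have K: "?K *v (\<Sigma> *v u) = u"
    by (simp add: matrix_vector_mul_assoc matrix_inv_left[OF inv])
  have "(\<Sigma> *v u) \<bullet> (?K *v x) = x \<bullet> (?K *v (\<Sigma> *v u))"
    using symmetric_matrix_inv[OF inv sym]
    by (metis dot_lmul_matrix inner_commute transpose_matrix_vector)
  then have "(x - \<Sigma> *v u) \<bullet> (?K *v (x - \<Sigma> *v u)) = x \<bullet> (?K *v x) - 2 * (u \<bullet> x) + u \<bullet> (\<Sigma> *v u)"
    by (simp add: matrix_vector_mult_diff_distrib inner_diff_left inner_diff_right K inner_commute)
  then have "- (x \<bullet> (?K *v x)) / 2 + u \<bullet> x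
      = u \<bullet> (\<Sigma> *v u) / 2 + - ((x - \<Sigma> *v u) \<bullet> (?K *v (x - \<Sigma> *v u))) / 2"
    by (simp add: field_simps)
  then have "exp (- (x \<bullet> (?K *v x)) / 2) * exp (u \<bullet> x)
      = exp (u \<bullet> (\<Sigma> *v u) / 2) * exp (- ((x - \<Sigma> *v u) \<bullet> (?K *v (x - \<Sigma> *v u))) / 2)"
    by (simp only: exp_add[symmetric])
  then show ?thesis by (simp add: gaussian_density_def)
qed

context
  fixes \<Sigma> :: "real^'p^'p"
  assumes pd: "pos_def \<Sigma>" and prob: "prob_space (centered_gaussian \<Sigma>)"
begin

text \<open>The tilted density is a multiple of a translate of the density, whose total mass is 1 by the
  assumption on the law.\<close>
lemma centered_gaussian_mgf:
  "has_bochner_integral (centered_gaussian \<Sigma>) (\<lambda>x. exp (u \<bullet> x)) (exp (u \<bullet> (\<Sigma> *v u) / 2))"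
proof (rule has_bochner_integral_nn_integral)
  let ?f = "gaussian_density \<Sigma>" and ?c = "exp (u \<bullet> (\<Sigma> *v u) / 2)"
  show "(\<lambda>x. exp (u \<bullet> x)) \<in> borel_measurable (centered_gaussian \<Sigma>)"
    by (simp add: centered_gaussian_density)
  have "(\<integral>\<^sup>+x. ennreal (exp (u \<bullet> x)) \<partial>centered_gaussian \<Sigma>)
      = (\<integral>\<^sup>+x. ennreal (?f x) * ennreal (exp (u \<bullet> x)) \<partial>lborel)"
    unfolding centered_gaussian_density by (rule nn_integral_density) auto
  also have "\<dots> = (\<integral>\<^sup>+x. ennreal ?c * ennreal (?f (- (\<Sigma> *v u) + 1 *\<^sub>R x)) \<partial>lborel)"
    unfolding ennreal_mult''[OF exp_ge_zero, symmetric] gaussian_density_tilt[OF pd]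
    by (simp add: ennreal_mult')
  also have "\<dots> = ennreal ?c * (\<integral>\<^sup>+x. ennreal (?f (- (\<Sigma> *v u) + 1 *\<^sub>R x)) \<partial>lborel)"
    by (rule nn_integral_cmult) auto
  also have "(\<integral>\<^sup>+x. ennreal (?f (- (\<Sigma> *v u) + 1 *\<^sub>R x)) \<partial>lborel) = (\<integral>\<^sup>+x. ennreal (?f x) \<partial>lborel)"
    by (rule nn_integral_lborel_affine) auto
  also have "\<dots> = emeasure (centered_gaussian \<Sigma>) (space (centered_gaussian \<Sigma>))"
    by (simp add: centered_gaussian_density emeasure_density)
  also have "\<dots> = 1" by (rule prob_space.emeasure_space_1[OF prob])
  finally show "(\<integral>\<^sup>+x. ennreal (exp (u \<bullet> x)) \<partial>centered_gaussian \<Sigma>) = ennreal ?c" by simp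
qed auto

text \<open>The density is even.\<close>
lemma centered_gaussian_mean: "(\<integral>x. x \<partial>centered_gaussian \<Sigma>) = 0"
proof -
  let ?N = "centered_gaussian \<Sigma>" and ?f = "gaussian_density \<Sigma>"
  have "distr ?N borel uminus = ?N"
  proof (rule measure_eqI)
    fix A assume "A \<in> sets (distr ?N borel uminus)"
    then have [measurable]: "A \<in> sets borel" by simp
    have even: "?f (- x) = ?f x" for x using matrix_vector_mult_scaleR[of "matrix_inv \<Sigma>" "-1" x] by (simp add: gaussian_density_def)
    have "emeasure (distr ?N borel uminus) A = (\<integral>\<^sup>+x. ennreal (?f x) * indicator A (- x) \<partial>lborel)"
    proof -
      have "uminus -` A \<in> sets borel"
        using measurable_sets[of "uminus :: real^'p \<Rightarrow> real^'p" borel borel A] by simp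
      moreover have "uminus \<in> measurable ?N borel" by (simp add: centered_gaussian_density)
      ultimately show ?thesis
        by (simp add: emeasure_distr centered_gaussian_density emeasure_density indicator_def)
    qed
    also have "\<dots> = (\<integral>\<^sup>+x. ennreal (?f (0 + (-1) *\<^sub>R x)) * indicator A (0 + (-1) *\<^sub>R x) \<partial>lborel)"
      by (simp add: even)
    also have "\<dots> = (\<integral>\<^sup>+x. ennreal (?f x) * indicator A x \<partial>lborel)"
      by (rule nn_integral_lborel_affine) auto
    also have "\<dots> = emeasure ?N A"
      by (simp add: centered_gaussian_density emeasure_density)
    finally show "emeasure (distr ?N borel uminus) A = emeasure ?N A" .
  qed (simp add: centered_gaussian_density)
  then have "(\<integral>x. x \<partial>?N) = (\<integral>x. x \<partial>distr ?N borel uminus)" by simp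
  also have "\<dots> = (\<integral>x. - x \<partial>?N)"
    by (rule integral_distr) (auto simp: centered_gaussian_density)
  also have "\<dots> = - (\<integral>x. x \<partial>?N)" by simp
  finally have "2 *\<^sub>R (\<integral>x. x \<partial>?N) = 0" by (simp only: scaleR_2 eq_neg_iff_add_eq_0)
  then show ?thesis by simp
qed

text \<open>The moment generating function of a linear functional gives its second moment, and polarization
  gives the mixed moments.\<close>
lemma centered_gaussian_cov: "cov_matrix (centered_gaussian \<Sigma>) = \<Sigma>"
proof -
  let ?N = "centered_gaussian \<Sigma>"
  have sym: "transpose \<Sigma> = \<Sigma>" using pd by (simp add: pos_def_def)
  have sq: "has_bochner_integral ?N (\<lambda>x. (v \<bullet> x)\<^sup>2) (v \<bullet> (\<Sigma> *v v))" for v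
  proof (rule second_moment_from_gaussian_mgf[OF _ prob])
    show "(\<lambda>x. v \<bullet> x) \<in> borel_measurable ?N" by (simp add: centered_gaussian_density)
    show "has_bochner_integral ?N (\<lambda>x. exp (t * (v \<bullet> x))) (exp (t\<^sup>2 * (v \<bullet> (\<Sigma> *v v)) / 2))" for t
      using centered_gaussian_mgf[of "t *\<^sub>R v"]
      by (simp add: matrix_vector_mult_scaleR power2_eq_square mult.assoc)
  qed
  have "(\<integral>x. x $ j * x $ k \<partial>?N) = \<Sigma> $ j $ k" for j k
  proof -
    let ?v = "axis j 1 + axis k 1" and ?w = "axis j 1 - axis k 1"
    have comp: "axis i 1 \<bullet> (\<Sigma> *v axis l 1) = \<Sigma> $ i $ l" for i l
      by (simp add: inner_axis' matrix_vector_mul_component inner_axis)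
    have "\<Sigma> $ k $ j = \<Sigma> $ j $ k" using sym by (metis transpose_def vec_lambda_beta)
    then have "(?v \<bullet> (\<Sigma> *v ?v) - ?w \<bullet> (\<Sigma> *v ?w)) / 4 = \<Sigma> $ j $ k"
      by (simp add: matrix_vector_right_distrib matrix_vector_mult_diff_distrib inner_add_left
          inner_add_right inner_diff_left inner_diff_right comp)
    moreover have "((?v \<bullet> x)\<^sup>2 - (?w \<bullet> x)\<^sup>2) / 4 = x $ j * x $ k" for x :: "real^'p"
      by (simp add: inner_add_left inner_diff_left inner_axis' power2_eq_square algebra_simps)
    ultimately have "has_bochner_integral ?N (\<lambda>x. x $ j * x $ k) (\<Sigma> $ j $ k)"
      using has_bochner_integral_divide[OF has_bochner_integral_diff[OF sq[of ?v] sq[of ?w]], of 4]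
      by simp
    then show ?thesis by (rule has_bochner_integral_integral_eq)
  qed
  then show ?thesis by (simp add: cov_matrix_def centered_gaussian_mean vec_eq_iff)
qed

lemma centered_gaussian_sub_gaussian: "sub_gaussian (sqrt (spectral_norm \<Sigma>)) (centered_gaussian \<Sigma>)"
  unfolding sub_gaussian_def
proof (intro allI impI conjI)
  fix v :: "real^'p" and t :: real
  assume v: "norm v = 1"
  have mgf: "has_bochner_integral (centered_gaussian \<Sigma>) (\<lambda>x. exp (t * (v \<bullet> x))) (exp (t\<^sup>2 * (v \<bullet> (\<Sigma> *v v)) / 2))"
    using centered_gaussian_mgf[of "t *\<^sub>R v"]
    by (simp add: matrix_vector_mult_scaleR power2_eq_square mult.assoc)
  then show "integrable (centered_gaussian \<Sigma>) (\<lambda>x. exp (t * (v \<bullet> x)))"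
    by (simp add: has_bochner_integral_iff)
  have "v \<bullet> (\<Sigma> *v v) \<le> norm v * norm (\<Sigma> *v v)" by (rule norm_cauchy_schwarz)
  also have "\<dots> \<le> spectral_norm \<Sigma>" using spectral_norm_bound[of \<Sigma> v] v by simp
  finally have "t\<^sup>2 * (v \<bullet> (\<Sigma> *v v)) \<le> t\<^sup>2 * spectral_norm \<Sigma>" by (intro mult_left_mono) auto
  then show "(\<integral>x. exp (t * (v \<bullet> x)) \<partial>centered_gaussian \<Sigma>) \<le> exp ((sqrt (spectral_norm \<Sigma>))\<^sup>2 * t\<^sup>2 / 2)"
    using has_bochner_integral_integral_eq[OF mgf] spectral_norm_nonneg[of \<Sigma>] by (simp add: mult.commute)
qed

end

section \<open>Concentration of the sample covariance matrix\<close>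

text \<open>A finite convex function on a Euclidean space is continuous.\<close>
lemma continuous_spectral_norm: "continuous_on UNIV (spectral_norm :: real^'n^'m \<Rightarrow> real)"
proof (rule convex_on_continuous)
  have scale: "spectral_norm (c *\<^sub>R A) = \<bar>c\<bar> * spectral_norm A" for c and A :: "real^'n^'m"
    unfolding spectral_norm_def scaleR_matrix_vector_assoc[symmetric]
    by (intro onorm_scaleR matrix_vector_mul_bounded_linear)
  show "convex_on UNIV (spectral_norm :: real^'n^'m \<Rightarrow> real)"
  proof (rule convex_onI)
    fix t :: real and A B :: "real^'n^'m"
    assume "0 < t" "t < 1"
    then show "spectral_norm ((1 - t) *\<^sub>R A + t *\<^sub>R B) \<le> (1 - t) * spectral_norm A + t * spectral_norm B"
      using spectral_norm_triangle[of "(1 - t) *\<^sub>R A" "t *\<^sub>R B"] by (simp add: scale)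
  qed simp
qed simp

lemma sample_cov_measurable:
  assumes "\<And>i. i < n \<Longrightarrow> (\<lambda>\<omega>. Y \<omega> i) \<in> borel_measurable M"
  shows "(\<lambda>\<omega>. sample_cov n (Y \<omega>) :: real^'p^'p) \<in> borel_measurable M"
proof (subst borel_measurable_euclidean_space, intro ballI)
  fix b :: "real^'p^'p"
  assume "b \<in> Basis"
  then obtain j k where b: "b = axis j (axis k 1)" by (auto simp: Basis_vec_def)
  have [measurable]: "(\<lambda>\<omega>. Y \<omega> i $ l) \<in> borel_measurable M" if "i < n" for i l
    by (rule borel_measurable_continuous_on[OF _ assms[OF that]]) (intro continuous_intros)
  show "(\<lambda>\<omega>. sample_cov n (Y \<omega>) \<bullet> b) \<in> borel_measurable M"
    unfolding b by (simp add: inner_axis sample_cov_def) measurable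
qed

lemma transpose_sample_cov: "transpose (sample_cov n x) = sample_cov n x"
  by (simp add: transpose_def sample_cov_def vec_eq_iff mult.commute)

lemma spectral_norm_pos_def_pos:
  assumes "pos_def (\<Sigma> :: real^'n^'n)" shows "0 < spectral_norm \<Sigma>"
proof -
  let ?v = "axis undefined 1 :: real^'n"
  have "0 < ?v \<bullet> (\<Sigma> *v ?v)" using assms by (simp add: pos_def_def)
  also have "\<dots> \<le> norm ?v * norm (\<Sigma> *v ?v)" by (rule norm_cauchy_schwarz)
  also have "\<dots> \<le> spectral_norm \<Sigma>" using spectral_norm_bound[of \<Sigma> ?v] by simp
  finally show ?thesis .
qed

text \<open>The concentration inequality speaks about the product law; independence identifies this law with
  the joint distribution of the sample. The inequality is used with \<open>\<sigma>\<^sup>2 = spectral_norm \<Sigma>\<close>,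
  where its threshold, multiplied by \<open>\<sigma>\<^sup>2\<close>, is at most \<open>thr\<close>.\<close>
lemma gaussian_sample_cov_deviation:
  fixes X :: "nat \<Rightarrow> 'w \<Rightarrow> real^'p"
  assumes P: "prob_space P"
    and indep: "prob_space.indep_vars P (\<lambda>_. borel) X {..<n}"
    and gaussian: "\<And>i. i < n \<Longrightarrow> distr P borel (X i) = centered_gaussian \<Sigma>"
    and pd: "pos_def \<Sigma>" and n: "1 \<le> n" and \<delta>: "0 \<le> \<delta>"
    and conc: "cov_concentration TYPE('p) c1 c2 c3"
    and thr: "spectral_norm \<Sigma> *
        (c1 * (sqrt (real CARD('p) / real n) + real CARD('p) / real n) + \<delta>) \<le> thr"
  defines "E \<equiv> {\<omega> \<in> space P. spectral_norm (sample_cov n (\<lambda>i. X i \<omega>) - \<Sigma>) < thr}"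
  shows "E \<in> sets P" and "measure P E \<ge> 1 - c2 * exp (- c3 * real n * min \<delta> (\<delta>\<^sup>2))"
proof -
  interpret prob_space P by (rule P)
  let ?N = "centered_gaussian \<Sigma>" and ?I = "{..<n}"
  let ?J = "PiM ?I (\<lambda>_. ?N)" and ?X = "\<lambda>\<omega>. \<lambda>i\<in>?I. X i \<omega>"
  have X[measurable]: "X i \<in> borel_measurable P" if "i < n" for i
    using indep that by (auto simp: indep_vars_def)
  have prob_N: "prob_space ?N"
    using gaussian[of 0] n prob_space_distr[OF X[of 0]] by simp
  have sets_N: "sets ?N = sets borel" by (simp add: centered_gaussian_density)
  have measurable_dev: "(\<lambda>\<omega>. spectral_norm (sample_cov n (Y \<omega>) - \<Sigma>)) \<in> borel_measurable M"
    if Y: "\<And>i. i < n \<Longrightarrow> (\<lambda>\<omega>. Y \<omega> i) \<in> borel_measurable M" for Y :: "'x \<Rightarrow> nat \<Rightarrow> real^'p" and M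
    by (rule borel_measurable_continuous_on[OF continuous_spectral_norm])
       (intro borel_measurable_diff sample_cov_measurable Y borel_measurable_const)
  show E: "E \<in> sets P"
    unfolding E_def using measurable_dev[of "\<lambda>\<omega> i. X i \<omega>" P] X by measurable
  have joint: "distr P (PiM ?I (\<lambda>_. borel)) ?X = ?J"
  proof -
    have "distr P (PiM ?I (\<lambda>_. borel)) ?X = PiM ?I (\<lambda>i. distr P borel (X i))"
      using indep_vars_iff_distr_eq_PiM'[where I = ?I and X = X and M' = "\<lambda>_. borel"] indep X n
      by (auto simp: lessThan_empty_iff)
    also have "\<dots> = ?J" using gaussian by (intro PiM_cong) auto
    finally show ?thesis .
  qed
  define D where "D = {x \<in> space ?J. thr \<le> spectral_norm (sample_cov n x - \<Sigma>)}"
  have comp: "(\<lambda>x. x i) \<in> borel_measurable ?J" if "i < n" for i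
    using measurable_component_singleton[of i ?I "\<lambda>_. ?N"] that
    by (simp add: measurable_cong_sets[OF refl sets_N])
  have D: "D \<in> sets ?J"
    unfolding D_def using measurable_dev[of "\<lambda>x. x" ?J] comp by measurable
  have sets_J: "sets ?J = sets (PiM ?I (\<lambda>_. borel))" by (intro sets_PiM_cong) (auto simp: sets_N)
  have X_meas: "?X \<in> measurable P (PiM ?I (\<lambda>_. borel))"
    by (rule measurable_restrict) (auto intro: X)
  have restrict: "sample_cov n (?X \<omega>) = sample_cov n (\<lambda>i. X i \<omega>)" for \<omega>
    by (simp add: sample_cov_def)
  have "measure ?J D = measure P (?X -` D \<inter> space P)"
    unfolding joint[symmetric] by (rule measure_distr[OF X_meas]) (use D sets_J in simp)
  also have "?X -` D \<inter> space P = space P - E"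
    using measurable_space[OF X_meas] sets_eq_imp_space_eq[OF sets_J]
    by (auto simp: D_def E_def restrict not_less)
  also have "measure P (space P - E) = 1 - measure P E" by (rule prob_compl[OF E])
  finally have mD: "measure ?J D = 1 - measure P E" .
  define s where "s = spectral_norm \<Sigma>"
  have s: "0 < s" using spectral_norm_pos_def_pos[OF pd] by (simp add: s_def)
  let ?b = "c1 * (sqrt (real CARD('p) / real n) + real CARD('p) / real n) + \<delta>"
  let ?D' = "{x \<in> space ?J. ?b \<le> spectral_norm (sample_cov n x - cov_matrix ?N) / (sqrt s)\<^sup>2}"
  have cov: "cov_matrix ?N = \<Sigma>" by (rule centered_gaussian_cov[OF pd prob_N])
  have D'_eq: "?D' = {x \<in> space ?J. ?b * s \<le> spectral_norm (sample_cov n x - \<Sigma>)}"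
    using s by (simp add: cov pos_le_divide_eq)
  have "measure ?J D \<le> measure ?J ?D'"
  proof (rule finite_measure.finite_measure_mono)
    show "finite_measure ?J" unfolding joint[symmetric]
      by (rule prob_space.finite_measure) (rule prob_space_distr[OF X_meas])
    show "D \<subseteq> ?D'" unfolding D'_eq using thr by (auto simp: D_def s_def mult.commute)
    show "?D' \<in> sets ?J"
      unfolding D'_eq using measurable_dev[of "\<lambda>x. x" ?J] comp by measurable
  qed
  also have "\<dots> \<le> c2 * exp (- c3 * real n * min \<delta> (\<delta>\<^sup>2))"
  proof -
    have "prob_space ?N \<and> sets ?N = sets borel \<and> (\<integral>x. x \<partial>?N) = 0 \<and> 0 < sqrt s
        \<and> sub_gaussian (sqrt s) ?N \<and> 1 \<le> n \<and> 0 \<le> \<delta>"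
      using prob_N sets_N centered_gaussian_mean[OF pd prob_N] s n \<delta>
        centered_gaussian_sub_gaussian[OF pd prob_N] by (simp add: s_def)
    with conc show ?thesis unfolding cov_concentration_def by blast
  qed
  finally show "measure P E \<ge> 1 - c2 * exp (- c3 * real n * min \<delta> (\<delta>\<^sup>2))"
    unfolding mD by linarith
qed

text \<open>The witnesses are \<open>t = q / L\<close> with \<open>q = sqrt (\<tau> ct p / n)\<close> and \<open>L = 4 + 8 c\<close>, so that
  \<open>L t sqrt d = \<epsilon>\<close>, and \<open>\<delta> = t / (2 c)\<close>, so that \<open>c \<delta>\<close> is half of \<open>t\<close>. The other half must
  dominate \<open>c c1 (x + x\<^sup>2)\<close> with \<open>x = sqrt (p / n)\<close>; this is the bound \<open>ct2\<close> once \<open>x \<le> 1\<close>. The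
  term \<open>1 / 4\<close> in the sample size condition gives \<open>q < 2\<close>, hence \<open>t \<le> 1\<close>, and also \<open>x \<le> 1\<close>
  because \<open>ct2\<close> and \<open>c1 c > 1\<close> force \<open>ct \<ge> 256\<close>. The bound \<open>ct1\<close> yields the exponent; its maximum with 1 serves the case \<open>\<delta> > 1\<close>, where
  \<open>\<delta> > t\<^sup>2\<close> replaces the comparison with \<open>\<delta>\<^sup>2\<close>.\<close>
lemma sample_size_constants:
  fixes n d p :: nat and c c1 c3 \<tau> ct cs :: real
  assumes c: "0 < c" and c1: "1 < c1 * c" "0 < c1" and c3: "0 < c3" and \<tau>: "1 < \<tau>" and d: "1 \<le> d" and p: "1 \<le> p"
    and ct1: "4 * max 1 (c\<^sup>2) * (4 + 8 * c)\<^sup>2 / c3 \<le> ct"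
    and ct2: "16 * c1\<^sup>2 * c\<^sup>2 * (4 + 8 * c)\<^sup>2 \<le> ct"
    and n: "real n > \<tau> * ct * real d * real p * max (cs\<^sup>2) (1 / 4)"
  defines "\<epsilon> \<equiv> sqrt (\<tau> * ct * real d * real p / real n)"
  obtains t \<delta> where "0 < n" "0 < t" "t \<le> 1" "0 \<le> \<delta>"
    and "c * (c1 * (sqrt (real p / real n) + real p / real n) + \<delta>) \<le> t"
    and "\<tau> * real p \<le> c3 * real n * min \<delta> (\<delta>\<^sup>2)"
    and "(4 + 8 * c) * t * sqrt (real d) = \<epsilon>"
    and "cs * \<epsilon> \<le> 1"
proof
  define L where "L = 4 + 8 * c"
  have L: "4 \<le> L" using c by (simp add: L_def)
  have c1c: "1 \<le> c1\<^sup>2 * c\<^sup>2" using c1 by (simp add: power_mult_distrib[symmetric] one_le_power)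
  have "16 * 1 * 4\<^sup>2 \<le> 16 * (c1\<^sup>2 * c\<^sup>2) * L\<^sup>2"
    using c1c L by (intro mult_mono power_mono) auto
  also have "\<dots> \<le> ct" using ct2 by (simp add: L_def mult.assoc)
  finally have ct: "256 \<le> ct" by simp
  have pos: "0 < \<tau> * ct * real p" using \<tau> ct p by simp
  have pos_d: "\<tau> * ct * real p \<le> \<tau> * ct * real d * real p"
    using mult_left_mono[of 1 "real d" "\<tau> * ct * real p"] pos d by (simp add: mult_ac)
  have n_lower: "\<tau> * ct * real p / 4 < real n"
    using mult_mono[OF pos_d, of "1 / 4" "max (cs\<^sup>2) (1 / 4)"] pos pos_d n by simp
  with pos have "0 < real n" by linarith
  then show n0: "0 < n" by simp
  define q where "q = sqrt (\<tau> * ct * real p / real n)"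
  have q0: "0 < q" using pos n0 by (simp add: q_def)
  have q2: "q\<^sup>2 = \<tau> * ct * real p / real n" using pos n0 by (simp add: q_def)
  have \<epsilon>: "\<epsilon> = q * sqrt (real d)"
    unfolding \<epsilon>_def q_def real_sqrt_mult[symmetric] by (simp add: mult_ac)
  have q2_less: "q\<^sup>2 < 4" using n_lower n0 by (simp add: q2 divide_less_eq)
  then have "q\<^sup>2 < 2\<^sup>2" by simp
  then have q_less: "q < 2" by (rule power2_less_imp_less) simp
  show "0 < q / L" using q0 L by simp
  show t1: "q / L \<le> 1" using q_less L by (simp add: divide_le_eq)
  show "0 \<le> q / L / (2 * c)" using q0 L c by simp
  define x where "x = sqrt (real p / real n)"
  have x0: "0 \<le> x" and x2: "x\<^sup>2 = real p / real n" by (simp_all add: x_def)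
  have "256 * x\<^sup>2 \<le> q\<^sup>2"
  proof -
    have "256 \<le> \<tau> * ct" using \<tau> ct mult_mono[of 1 \<tau> 256 ct] by simp
    then have "256 * x\<^sup>2 \<le> \<tau> * ct * x\<^sup>2" by (intro mult_right_mono) auto
    then show ?thesis by (simp add: q2 x2)
  qed
  with q2_less have "x\<^sup>2 \<le> 1\<^sup>2" by simp
  then have x1: "x \<le> 1" by (rule power2_le_imp_le) simp
  have q_ge: "4 * (c1 * c * L) * x \<le> q"
  proof (rule power2_le_imp_le)
    have "(4 * (c1 * c * L) * x)\<^sup>2 = (16 * c1\<^sup>2 * c\<^sup>2 * L\<^sup>2) * x\<^sup>2" by (simp add: power_mult_distrib)
    also have "\<dots> \<le> ct * x\<^sup>2" using ct2 by (intro mult_right_mono) (auto simp: L_def)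
    also have "\<dots> \<le> \<tau> * ct * x\<^sup>2" using \<tau> ct by (intro mult_right_mono) auto
    also have "\<dots> = q\<^sup>2" by (simp add: q2 x2)
    finally show "(4 * (c1 * c * L) * x)\<^sup>2 \<le> q\<^sup>2" .
  qed (use q0 in simp)
  have "c * c1 * (x + x\<^sup>2) \<le> c * c1 * (2 * x)"
    using x0 x1 c c1 mult_left_mono[of x 1 x] by (intro mult_left_mono) (auto simp: power2_eq_square)
  also have "\<dots> \<le> q / L / 2" using q_ge L by (simp add: field_simps)
  finally have "c * c1 * (x + x\<^sup>2) \<le> q / L / 2" .
  then show "c * (c1 * (sqrt (real p / real n) + real p / real n) + q / L / (2 * c)) \<le> q / L"
    using c unfolding x2 by (simp add: x_def algebra_simps)
  show "\<tau> * real p \<le> c3 * real n * min (q / L / (2 * c)) ((q / L / (2 * c))\<^sup>2)"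
  proof -
    define \<delta> where "\<delta> = q / L / (2 * c)"
    have nq: "real n * q\<^sup>2 = \<tau> * ct * real p" using n0 by (simp add: q2)
    have ctL: "4 * max 1 (c\<^sup>2) * L\<^sup>2 \<le> c3 * ct"
      using ct1 c3 by (simp add: L_def divide_le_eq mult.commute)
    have ctL1: "4 * L\<^sup>2 \<le> c3 * ct" and ctL2: "4 * c\<^sup>2 * L\<^sup>2 \<le> c3 * ct"
      by (rule order_trans[OF _ ctL], intro mult_right_mono; simp)+
    have t2: "\<tau> * real p \<le> c3 * real n * (q / L)\<^sup>2"
    proof -
      have "\<tau> * real p * L\<^sup>2 \<le> \<tau> * real p * (c3 * ct)"
        using ctL1 \<tau> by (intro mult_left_mono) (auto intro: order_trans[OF _ ctL1])
      also have "\<dots> = c3 * (real n * q\<^sup>2)" by (simp add: nq)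
      finally show ?thesis using L by (simp add: power_divide field_simps)
    qed
    have \<delta>2: "\<tau> * real p \<le> c3 * real n * \<delta>\<^sup>2"
    proof -
      have "\<tau> * real p * (4 * c\<^sup>2 * L\<^sup>2) \<le> \<tau> * real p * (c3 * ct)"
        using ctL2 \<tau> by (intro mult_left_mono) auto
      also have "\<dots> = c3 * (real n * q\<^sup>2)" by (simp add: nq)
      finally show ?thesis using L c by (simp add: \<delta>_def power_divide power_mult_distrib field_simps)
    qed
    have \<delta>1: "\<tau> * real p \<le> c3 * real n * \<delta>" if "1 < \<delta>"
    proof -
      have "(q / L)\<^sup>2 \<le> 1" using t1 q0 L by (simp add: power_le_one)
      then have "c3 * real n * (q / L)\<^sup>2 \<le> c3 * real n * \<delta>"
        using that c3 by (intro mult_left_mono) auto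
      with t2 show ?thesis by linarith
    qed
    have "\<tau> * real p \<le> c3 * real n * min \<delta> (\<delta>\<^sup>2)"
    proof (cases "1 < \<delta>")
      case True
      then have "\<delta> \<le> \<delta>\<^sup>2" by (simp add: power2_eq_square)
      then show ?thesis using \<delta>1[OF True] by (simp add: min_def)
    next
      case False
      have "0 \<le> \<delta>" using q0 L c by (simp add: \<delta>_def)
      with False have "\<delta>\<^sup>2 \<le> \<delta>" using mult_left_mono[of \<delta> 1 \<delta>] by (simp add: power2_eq_square)
      then show ?thesis using \<delta>2 by (simp add: min_absorb2)
    qed
    then show ?thesis unfolding \<delta>_def .
  qed
  show "(4 + 8 * c) * (q / L) * sqrt (real d) = \<epsilon>"
    using L by (simp add: \<epsilon> L_def[symmetric])
  show "cs * \<epsilon> \<le> 1"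
  proof (rule power2_le_imp_le)
    have "\<tau> * ct * real d * real p * cs\<^sup>2 \<le> \<tau> * ct * real d * real p * max (cs\<^sup>2) (1 / 4)"
      using pos pos_d by (intro mult_left_mono) auto
    with n have *: "\<tau> * ct * real d * real p * cs\<^sup>2 \<le> real n" by linarith
    have "\<epsilon>\<^sup>2 = \<tau> * ct * real d * real p / real n" using pos pos_d by (simp add: \<epsilon>_def)
    then have "(cs * \<epsilon>)\<^sup>2 = \<tau> * ct * real d * real p * cs\<^sup>2 / real n" by (simp add: power_mult_distrib)
    also have "\<dots> \<le> 1" using * n0 by simp
    finally show "(cs * \<epsilon>)\<^sup>2 \<le> 1\<^sup>2" by simp
  qed simp
qed

section \<open>Recovery for the Direct Lyapunov Lasso\<close>

lemma infnorm_matrix_less: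
  assumes "\<And>j k. \<bar>M $ j $ k\<bar> < b"
  shows "infnorm (M :: real^'n^'m) < b"
proof -
  have "\<bar>M \<bullet> e\<bar> < b" if "e \<in> Basis" for e
    using that assms by (auto simp: Basis_vec_def inner_axis)
  then show ?thesis by (simp add: infnorm_Max)
qed

lemma matrix_component_le_infnorm: "\<bar>M $ j $ k\<bar> \<le> infnorm (M :: real^'n^'m)"
proof -
  have "axis j (axis k 1) \<in> (Basis :: (real^'n^'m) set)" by (auto simp: Basis_vec_def)
  from Basis_le_infnorm[OF this, of M] show ?thesis by (simp add: inner_axis)
qed

lemma sgn_eq_if_close:
  fixes x y :: real
  assumes "\<bar>x - y\<bar> < \<bar>y\<bar>"
  shows "sgn x = sgn y"
  using assms by (auto simp: sgn_real_def abs_if split: if_splits)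

text \<open>The deterministic part of the result, for any symmetric \<open>\<Sigma>hat\<close> close to \<open>\<Sigma>\<close>. The condition
  \<open>t \<le> 1\<close> turns the bounds that are quadratic in the deviation into linear ones: both
  \<open>4 t + 8 c\<close> and \<open>4 (c + t)\<close>, where \<open>c\<close> is the spectral norm of \<open>\<Sigma>\<close>, are at most \<open>4 + 8 c\<close>.\<close>
lemma lyap_lasso_support_recovery:
  fixes M Mhat C \<Sigma> \<Sigma>hat :: "real^'p^'p"
  assumes \<Sigma>: "transpose \<Sigma> = \<Sigma>" "M ** \<Sigma> + \<Sigma> ** transpose M + C = 0"
    and \<Sigma>hat: "transpose \<Sigma>hat = \<Sigma>hat"
    and S: "S = mat_support M" "S \<noteq> {}"
    and inv: "submat_invertible S (gram_matrix \<Sigma>)"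
    and \<alpha>: "0 < \<alpha>" "\<alpha> \<le> 1"
    and irrep: "row_sum_norm (submat (- S) S (gram_matrix \<Sigma>) ** submat_inv S (gram_matrix \<Sigma>)) < 1 - \<alpha>"
    and dev: "spectral_norm (\<Sigma>hat - \<Sigma>) \<le> t" "t \<le> 1"
    and \<epsilon>: "(4 + 8 * spectral_norm \<Sigma>) * t * sqrt (card S) = \<epsilon>"
      "row_sum_norm (submat_inv S (gram_matrix \<Sigma>)) * \<epsilon> \<le> \<alpha> / 6"
    and lam: "3 * infnorm (vectorize M) * (2 - \<alpha>) / \<alpha> * \<epsilon> < lam"
    and Mhat: "lyap_lasso_minimizer C lam \<Sigma>hat Mhat"
  defines "b \<equiv> 2 * row_sum_norm (submat_inv S (gram_matrix \<Sigma>)) / (2 - \<alpha>) * lam"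
  shows "lyap_lasso_minimizer C lam \<Sigma>hat M' \<Longrightarrow> M' = Mhat"
    and "mat_support Mhat \<subseteq> S"
    and "infnorm (Mhat - M) < b"
proof -
  define \<Delta> where "\<Delta> = \<Sigma>hat - \<Sigma>"
  have \<Sigma>hat_eq: "\<Sigma>hat = \<Sigma> + \<Delta>" by (simp add: \<Delta>_def)
  have \<Delta>: "transpose \<Delta> = \<Delta>" using \<Sigma> \<Sigma>hat by (simp add: \<Delta>_def transpose_def vec_eq_iff)
  define s c where "s = spectral_norm \<Delta>" and "c = spectral_norm \<Sigma>"
  have s: "0 \<le> s" "s \<le> t" "s \<le> 1" and c: "0 \<le> c"
    using dev by (auto simp: s_def c_def \<Delta>_def spectral_norm_nonneg)
  let ?A = "lyap_matrix \<Sigma>hat" and ?c = "vectorize C" and ?m = "vectorize M"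
  have \<epsilon>0: "0 \<le> \<epsilon>" using \<epsilon>(1) s c by (auto simp: c_def)
  have lam0: "0 < lam"
  proof -
    have "0 \<le> 3 * infnorm ?m * (2 - \<alpha>) / \<alpha> * \<epsilon>" using \<alpha> \<epsilon>0 by (simp add: infnorm_pos_le)
    with lam show ?thesis by linarith
  qed
  have supp: "?m $ j = 0" if "j \<notin> S" for j
    using that by (auto simp: S(1) mat_support_def vectorize_def)
  have vec_eq: "X = Y" if "vectorize X = vectorize Y" for X Y :: "real^'p^'p"
    using that by (simp add: vectorize_def vec_eq_iff)
  have obj: "lyap_lasso_minimizer C lam \<Sigma>hat X \<longleftrightarrow>
      (\<forall>m. lasso_objective ?A ?c lam (vectorize X) \<le> lasso_objective ?A ?c lam m)" for X
    unfolding lyap_lasso_minimizer_def is_arg_min_linorder lyap_lasso_objective_vectorize[OF \<Sigma>hat]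
    by (metis vectorize_surj)
  have E: "\<bar>((transpose ?A ** ?A) *v u) $ j - (gram_matrix \<Sigma> *v u) $ j\<bar> \<le> \<epsilon> * K"
    if u: "\<And>j. j \<notin> S \<Longrightarrow> u $ j = 0" and K: "\<And>j. \<bar>u $ j\<bar> \<le> K" for u K j
  proof -
    have K0: "0 \<le> K" using K[of undefined] by linarith
    have "\<bar>((transpose ?A ** ?A) *v u) $ j - (gram_matrix \<Sigma> *v u) $ j\<bar>
        \<le> (4 * s + 8 * c) * s * sqrt (card S) * K"
      using gram_matrix_perturbation[OF \<Sigma>(1) \<Delta> u K, where j = j]
      by (simp add: gram_matrix_def[of "\<Sigma> + \<Delta>"] \<Sigma>hat_eq s_def c_def)
    also have "\<dots> \<le> (4 + 8 * c) * t * sqrt (card S) * K"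
      using s c K0 by (intro mult_right_mono mult_mono) auto
    also have "\<dots> = \<epsilon> * K" using \<epsilon>(1) by (simp add: c_def)
    finally show ?thesis .
  qed
  have r: "\<bar>lasso_gradient ?A ?c ?m $ j\<bar> < \<alpha> / (3 * (2 - \<alpha>)) * lam" for j
  proof -
    have "\<bar>lasso_gradient ?A ?c ?m $ j\<bar> \<le> 4 * (c + s) * s * norm M"
      using lyap_gradient_at_truth[OF \<Sigma>(1) \<Delta> \<Sigma>(2), where j = j] by (simp add: \<Sigma>hat_eq s_def c_def)
    also have "norm M \<le> sqrt (card S) * infnorm ?m"
      using norm_le_sqrt_card_support[of S ?m "infnorm ?m"] supp component_le_infnorm_cart[of ?m]
      by (simp add: norm_vectorize)
    also have "4 * (c + s) * s * (sqrt (card S) * infnorm ?m)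
        \<le> (4 + 8 * c) * t * (sqrt (card S) * infnorm ?m)"
      using s c by (intro mult_right_mono mult_mono) (auto simp: infnorm_pos_le)
    also have "\<dots> = infnorm ?m * \<epsilon>" using \<epsilon>(1) by (simp add: c_def)
    also have "\<dots> < \<alpha> / (3 * (2 - \<alpha>)) * lam"
      using lam \<alpha> by (simp add: field_simps)
    \<comment> \<open>the remaining side condition is the monotonicity used to replace \<open>norm M\<close>\<close>
    finally show ?thesis using s c by (simp add: mult_left_mono)
  qed
  have min: "lasso_objective ?A ?c lam (vectorize Mhat) \<le> lasso_objective ?A ?c lam m" for m
    using Mhat by (simp add: obj)
  note recovery = lasso_support_recovery[OF lam0 \<alpha> _ is_submat_inv_submat_inv[OF inv] irrep _
      \<epsilon>0 \<epsilon>(2) r min]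
  show "M' = Mhat" if "lyap_lasso_minimizer C lam \<Sigma>hat M'"
    using that unfolding obj by (intro vec_eq recovery(2)) (use supp E in blast)+
  show "mat_support Mhat \<subseteq> S"
  proof
    fix r assume "r \<in> mat_support Mhat"
    then have "vectorize Mhat $ r \<noteq> 0" by (auto simp: mat_support_def vectorize_def)
    moreover have "vectorize Mhat $ r = 0" if "r \<notin> S"
      by (rule recovery(1)) (use supp E that in blast)+
    ultimately show "r \<in> S" by blast
  qed
  show "infnorm (Mhat - M) < b"
  proof (rule infnorm_matrix_less)
    fix j k
    have "\<bar>(vectorize Mhat - ?m) $ (j, k)\<bar> < b"
      unfolding b_def by (rule recovery(3)) (use supp E S(2) in blast)+
    then show "\<bar>(Mhat - M) $ j $ k\<bar> < b" by (simp add: vectorize_def)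
  qed
qed

lemma sign_recovery:
  fixes M Mhat :: "real^'p^'p"
  assumes S: "S = mat_support M" and sub: "mat_support Mhat \<subseteq> S"
    and close: "infnorm (Mhat - M) < b" and min: "b < Min ((\<lambda>(j, k). \<bar>M $ j $ k\<bar>) ` S)"
  shows "mat_support Mhat = S" and "\<forall>(j, k)\<in>S. sgn (Mhat $ j $ k) = sgn (M $ j $ k)"
proof -
  have sgn: "sgn (Mhat $ j $ k) = sgn (M $ j $ k)" if "(j, k) \<in> S" for j k
  proof (rule sgn_eq_if_close)
    have "\<bar>Mhat $ j $ k - M $ j $ k\<bar> \<le> infnorm (Mhat - M)"
      using matrix_component_le_infnorm[of "Mhat - M" j k] by simp
    also have "\<dots> < Min ((\<lambda>(j, k). \<bar>M $ j $ k\<bar>) ` S)" using close min by linarith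
    also have "\<dots> \<le> \<bar>M $ j $ k\<bar>" using that by (intro Min_le) force+
    finally show "\<bar>Mhat $ j $ k - M $ j $ k\<bar> < \<bar>M $ j $ k\<bar>" .
  qed
  then show "\<forall>(j, k)\<in>S. sgn (Mhat $ j $ k) = sgn (M $ j $ k)" by auto
  have "(j, k) \<in> mat_support Mhat" if "(j, k) \<in> S" for j k
    using sgn[OF that] that S by (auto simp: mat_support_def sgn_0_0)
  with sub show "mat_support Mhat = S" by auto
qed

theorem theorem3p1:
  fixes Mstar C \<Sigma>star :: "real^'p^'p"
    and \<Gamma>star :: "real^('p \<times> 'p)^('p \<times> 'p)"
    and P :: "'w measure"
    and X :: "nat \<Rightarrow> 'w \<Rightarrow> real^'p"
    and Mhat :: "'w \<Rightarrow> real^'p^'p"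
    and S :: "('p \<times> 'p) set"
    and n d p :: nat
    and c1 c2 c3 \<alpha> \<tau>1 lam c_\<Gamma> c_M c_\<Sigma> c_C c_tilde c_star :: real
  assumes p: "p = CARD('p)"
    and stable: "stable Mstar"
    and C: "pos_def C"
    and \<Sigma>star: "pos_def \<Sigma>star" "Mstar ** \<Sigma>star + \<Sigma>star ** transpose Mstar + C = 0"
    and P: "prob_space P"
    and indep: "prob_space.indep_vars P (\<lambda>_. borel) X {..<n}"
    and gaussian: "\<And>i. i < n \<Longrightarrow> distr P borel (X i) = centered_gaussian \<Sigma>star"
    and S: "S = mat_support Mstar"
    and d: "d = card S"
    and \<Gamma>star: "\<Gamma>star = gram_matrix \<Sigma>star"
    and \<Gamma>_SS: "submat_invertible S \<Gamma>star"
    and \<alpha>: "0 < \<alpha>" "\<alpha> \<le> 1"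
    and irrepresentability:
      "row_sum_norm (submat (- S) S \<Gamma>star ** submat_inv S \<Gamma>star) < 1 - \<alpha>"
    and c_\<Gamma>: "c_\<Gamma> = row_sum_norm (submat_inv S \<Gamma>star)"
    and c_M: "c_M = infnorm (vectorize Mstar)"
    and c_\<Sigma>: "c_\<Sigma> = spectral_norm \<Sigma>star"
    and c_C: "c_C = norm (vectorize C)"
    and constants: "c1 > 0" "c2 > 0" "c3 > 0" "cov_concentration TYPE('p) c1 c2 c3"
    and c1: "c1 > max 1 (1 / spectral_norm \<Sigma>star)"
    and c_tilde: "c_tilde = Max {4 * max 1 (c_\<Sigma>\<^sup>2) * (4 + 8 * c_\<Sigma>)\<^sup>2 / c3,
                                 16 * c1\<^sup>2 * c_\<Sigma>\<^sup>2 * (4 + 8 * c_\<Sigma>)\<^sup>2,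
                                 16 * max 1 (c_\<Sigma>\<^sup>2) * c_C\<^sup>2 / c3,
                                 64 * c1\<^sup>2 * c_\<Sigma>\<^sup>2 * c_C\<^sup>2}"
    and c_star: "c_star = 6 / \<alpha> * c_\<Gamma>"
    and \<tau>1: "\<tau>1 > 1"
    and n: "real n > \<tau>1 * c_tilde * real d * real p * max (c_star\<^sup>2) (1 / 4)"
    and lam: "lam > 3 * c_M * (2 - \<alpha>) / \<alpha> * sqrt (\<tau>1 * c_tilde * real d * real p / real n)"
    and Mhat: "\<And>\<omega>. \<omega> \<in> space P \<Longrightarrow>
                 lyap_lasso_minimizer C lam (sample_cov n (\<lambda>i. X i \<omega>)) (Mhat \<omega>)"
  shows "\<exists>E \<in> sets P. measure P E \<ge> 1 - c2 * exp (- \<tau>1 * real p) \<and>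
    (\<forall>\<omega>\<in>E.
       ((\<forall>M. lyap_lasso_minimizer C lam (sample_cov n (\<lambda>i. X i \<omega>)) M \<longrightarrow> M = Mhat \<omega>) \<and>
        mat_support (Mhat \<omega>) \<subseteq> S \<and>
        infnorm (Mhat \<omega> - Mstar) < 2 * c_\<Gamma> / (2 - \<alpha>) * lam) \<and>
       (Min ((\<lambda>(j, k). \<bar>Mstar $ j $ k\<bar>) ` S) > 2 * c_\<Gamma> / (2 - \<alpha>) * lam \<longrightarrow>
        mat_support (Mhat \<omega>) = S \<and>
        (\<forall>(j, k)\<in>S. sgn (Mhat \<omega> $ j $ k) = sgn (Mstar $ j $ k))))"
proof -
  have sym: "transpose \<Sigma>star = \<Sigma>star" using \<Sigma>star(1) by (simp add: pos_def_def)
  have S_ne: "S \<noteq> {}"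
  proof
    assume "S = {}"
    then have "Mstar = 0" by (auto simp: S mat_support_def vec_eq_iff)
    then have "C = 0" using \<Sigma>star(2) by (simp add: transpose_def matrix_matrix_mult_def vec_eq_iff)
    then have "\<not> 0 < axis undefined 1 \<bullet> (C *v axis undefined 1)" by simp
    then show False using C by (auto simp: pos_def_def)
  qed
  have card: "1 \<le> d" "1 \<le> p" using S_ne by (simp_all add: d p card_gt_0_iff Suc_le_eq)
  have c0: "0 < c_\<Sigma>" unfolding c_\<Sigma> by (rule spectral_norm_pos_def_pos[OF \<Sigma>star(1)])
  have c1c: "1 < c1 * c_\<Sigma>" using c1 c0 by (simp add: c_\<Sigma> divide_less_eq)
  have ct1: "4 * max 1 (c_\<Sigma>\<^sup>2) * (4 + 8 * c_\<Sigma>)\<^sup>2 / c3 \<le> c_tilde"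
    and ct2: "16 * c1\<^sup>2 * c_\<Sigma>\<^sup>2 * (4 + 8 * c_\<Sigma>)\<^sup>2 \<le> c_tilde"
    unfolding c_tilde by (rule Max_ge; simp)+
  obtain t \<delta> where t: "0 < n" "0 < t" "t \<le> 1" "0 \<le> \<delta>"
    and thr: "c_\<Sigma> * (c1 * (sqrt (real p / real n) + real p / real n) + \<delta>) \<le> t"
    and rate: "\<tau>1 * real p \<le> c3 * real n * min \<delta> (\<delta>\<^sup>2)"
    and \<epsilon>: "(4 + 8 * c_\<Sigma>) * t * sqrt (real d) = sqrt (\<tau>1 * c_tilde * real d * real p / real n)"
    and cs: "c_star * sqrt (\<tau>1 * c_tilde * real d * real p / real n) \<le> 1"
    by (rule sample_size_constants[OF c0 c1c constants(1,3) \<tau>1 card ct1 ct2 n])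
  define E where "E = {\<omega> \<in> space P. spectral_norm (sample_cov n (\<lambda>i. X i \<omega>) - \<Sigma>star) < t}"
  have n1: "1 \<le> n" using t(1) by simp
  note dev = gaussian_sample_cov_deviation[OF P indep gaussian \<Sigma>star(1) n1 t(4) constants(4)
      thr[unfolded c_\<Sigma> p], folded E_def]
  have "c2 * exp (- c3 * real n * min \<delta> (\<delta>\<^sup>2)) \<le> c2 * exp (- \<tau>1 * real p)"
    using rate constants(2) by simp
  with dev(2) have prob: "1 - c2 * exp (- \<tau>1 * real p) \<le> measure P E" by linarith
  have on_E: "(\<forall>M. lyap_lasso_minimizer C lam (sample_cov n (\<lambda>i. X i \<omega>)) M \<longrightarrow> M = Mhat \<omega>) \<and>
      mat_support (Mhat \<omega>) \<subseteq> S \<and> infnorm (Mhat \<omega> - Mstar) < 2 * c_\<Gamma> / (2 - \<alpha>) * lam"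
    if \<omega>: "\<omega> \<in> E" for \<omega>
  proof -
    have "spectral_norm (sample_cov n (\<lambda>i. X i \<omega>) - \<Sigma>star) \<le> t" using \<omega> by (simp add: E_def)
    moreover have "row_sum_norm (submat_inv S (gram_matrix \<Sigma>star))
        * sqrt (\<tau>1 * c_tilde * real d * real p / real n) \<le> \<alpha> / 6"
      using cs \<alpha> by (simp add: c_star c_\<Gamma> \<Gamma>star field_simps)
    moreover have "\<omega> \<in> space P" using \<omega> by (simp add: E_def)
    ultimately show ?thesis
      using lyap_lasso_support_recovery[OF sym \<Sigma>star(2) transpose_sample_cov S S_ne
          \<Gamma>_SS[unfolded \<Gamma>star] \<alpha> irrepresentability[unfolded \<Gamma>star] _ t(3)
          \<epsilon>[unfolded c_\<Sigma> d] _ lam[unfolded c_M d] Mhat]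
      by (simp add: c_\<Gamma> \<Gamma>star d)
  qed
  have signs: "mat_support (Mhat \<omega>) = S \<and> (\<forall>(j, k)\<in>S. sgn (Mhat \<omega> $ j $ k) = sgn (Mstar $ j $ k))"
    if "\<omega> \<in> E" "Min ((\<lambda>(j, k). \<bar>Mstar $ j $ k\<bar>) ` S) > 2 * c_\<Gamma> / (2 - \<alpha>) * lam" for \<omega>
    using sign_recovery[OF S _ _ that(2), of "Mhat \<omega>"] on_E[OF that(1)] by blast
  show ?thesis
    by (rule bexI[OF _ dev(1)]) (use prob on_E signs in blast)
qed

end
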